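(* Let $X,Y$ be smooth vector fields on the flag manifold $(\mathcal{F}^{\mathrm I},g^{\mathcal F})$. Then, for any $\beta=(\beta_i)_{1\le i\le r}\in\mathcal{F}^{\mathrm I}$, the Levi-Civita connection satisfies $$\left(\nabla^{\mathcal{F}^{\mathrm I}}_XY\right)_\beta=\left(\left[\!\left[\Omega'(\beta)-\frac18\,\Omega_\beta(X,Y),\ \beta_i\right]\!\right]\right)_{1\le i\le r},$$ where $$\Omega'(\beta)=\frac12\left.\frac{d}{dt}\right|_{t=0}\left(\sum_{j=1}^r[\![Y_j(\Gamma(t)),(\Gamma(t))_j]\!]\right)\in\mathfrak{so}(n),$$ $\Gamma$ is the geodesic in $(\mathcal{F}^{\mathrm I},g^{\mathcal F})$ through $\beta$ in the direction $X(\beta)$, and $$\Omega_\beta(X,Y)=\sum_{i,j=1}^r[\![\,[\![X_i(\beta),\beta_i]\!],\ [\![Y_j(\beta),\beta_j]\!]\,]\!]\in\mathfrak{so}(n).$$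
   Context: $[\![A,B]\!]=AB-BA$ for $n\times n$ real matrices. A type is $\mathrm I=(q_i)_{1\le i\le r}$, $r\ge2$, of positive integers with $\sum_iq_i=n$. For $1\le q\le n$, $G_q=\{P\in\mathbb{R}^{n\times n}:P^2=P,\ P^T=P,\ \mathrm{rank}(P)=q\}\subset\mathrm{Sym}_n$. The flag manifold is $\mathcal{F}^{\mathrm I}=\{(P_i)_{1\le i\le r}\in\prod_iG_{q_i}:P_iP_j=0\text{ for }i\ne j\}$. $SO(n)$ acts by $Q\cdot(P_i)_i=(QP_iQ^T)_i$. The standard flag is $\mathcal{P}_0=(P_0^i)_i$, with $P_0^i=\mathrm{Diag}[0_{q_1},\dots,I_{q_i},\dots,0_{q_r}]$ (block diagonal); $\mathcal{F}^{\mathrm I}$ is its orbit, with isotropy group $SO(\mathrm I)=SO(n)\cap\prod_iO(q_i)$. $SO(n)$ carries the bi-invariant metric $g^O_Q(Q\Omega,Q\widetilde\Omega)=\frac12\mathrm{tr}(\Omega^T\widetilde\Omega)$, $\Omega,\widetilde\Omega\in\mathfrak{so}(n)$ (skew-symmetric matrices), and $g^{\mathcal F}$ is the metric on $\mathcal{F}^{\mathrm I}$ for which the diffeomorphism $SO(n)/SO(\mathrm I)\to\mathcal{F}^{\mathrm I}$ induced by $Q\mapsto Q\cdot\mathcal{P}_0$ is an isometry, $SO(n)/SO(\mathrm I)$ having the quotient metric of $g^O$. Tangent vectors to $\mathcal{F}^{\mathrm I}$ are $r$-tuples of symmetric matrices; for a vector field $X$, $X_i(\mathcal P)=(X(\mathcal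 P))_i\in T_{P_i}G_{q_i}\subset\mathrm{Sym}_n$. *)

theory Defs
  imports "HOL-Analysis.Analysis"
begin

section \<open>Smooth maps and tangent spaces of embedded submanifolds\<close>

text \<open>
  Manifolds are subsets of a Euclidean space, with the submanifold structure. A map on a subset is
  smooth if near each point it is the restriction of a smooth map on an open set of the ambient
  space.
\<close>

primrec Ck_on :: "nat \<Rightarrow> 'a::euclidean_space set \<Rightarrow> ('a \<Rightarrow> 'b::real_normed_vector) \<Rightarrow> bool" where
  "Ck_on 0 U f \<longleftrightarrow> continuous_on U f"
| "Ck_on (Suc k) U f \<longleftrightarrow>
     (\<forall>x\<in>U. f differentiable (at x)) \<and> (\<forall>v. Ck_on k U (\<lambda>x. frechet_derivative f (at x) v))"

definition smooth_on :: "'a::euclidean_space set \<Rightarrow> ('a \<Rightarrow> 'b::real_normed_vector) \<Rightarrow> bool" where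
  "smooth_on M f \<longleftrightarrow>
     (\<forall>p\<in>M. \<exists>U h. open U \<and> p \<in> U \<and> (\<forall>k. Ck_on k U h) \<and> (\<forall>x\<in>U \<inter> M. h x = f x))"

definition curve_through :: "'a::euclidean_space set \<Rightarrow> 'a \<Rightarrow> 'a \<Rightarrow> (real \<Rightarrow> 'a) \<Rightarrow> bool" where
  "curve_through M p v c \<longleftrightarrow>
     (\<exists>e>0. smooth_on {-e<..<e} c \<and> c ` {-e<..<e} \<subseteq> M)
     \<and> c 0 = p \<and> (c has_vector_derivative v) (at 0)"

definition tangent_space :: "'a::euclidean_space set \<Rightarrow> 'a \<Rightarrow> 'a set" where
  "tangent_space M p = {v. \<exists>c. curve_through M p v c}"

text \<open>The differential of \<open>f\<close> at \<open>p\<close> applied to a tangent vector \<open>v\<close>.\<close>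

definition mfd_deriv ::
  "'a::euclidean_space set \<Rightarrow> ('a \<Rightarrow> 'b::real_normed_vector) \<Rightarrow> 'a \<Rightarrow> 'a \<Rightarrow> 'b" where
  "mfd_deriv M f p v =
     (THE w. \<forall>c. curve_through M p v c \<longrightarrow> ((f \<circ> c) has_vector_derivative w) (at 0))"

text \<open>
  Only the values on \<open>M\<close> of a vector field on \<open>M\<close> are meaningful, so identities between vector
  fields below are required at points of \<open>M\<close> only.
\<close>

definition vector_fields :: "'a::euclidean_space set \<Rightarrow> ('a \<Rightarrow> 'a) set" where
  "vector_fields M = {X. smooth_on M X \<and> (\<forall>p\<in>M. X p \<in> tangent_space M p)}"


section \<open>Connections and geodesics\<close>

definition affine_connection ::
  "'a::euclidean_space set \<Rightarrow> (('a \<Rightarrow> 'a) \<Rightarrow> ('a \<Rightarrow> 'a) \<Rightarrow> 'a \<Rightarrow> 'a) \<Rightarrow> bool" where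
  "affine_connection M nabla \<longleftrightarrow>
     (\<forall>X\<in>vector_fields M. \<forall>Y\<in>vector_fields M. nabla X Y \<in> vector_fields M) \<and>
     (\<forall>X\<in>vector_fields M. \<forall>X'\<in>vector_fields M. \<forall>Y\<in>vector_fields M. \<forall>p\<in>M.
        nabla (\<lambda>x. X x + X' x) Y p = nabla X Y p + nabla X' Y p) \<and>
     (\<forall>X\<in>vector_fields M. \<forall>Y\<in>vector_fields M. \<forall>Y'\<in>vector_fields M. \<forall>p\<in>M.
        nabla X (\<lambda>x. Y x + Y' x) p = nabla X Y p + nabla X Y' p) \<and>
     (\<forall>X\<in>vector_fields M. \<forall>Y\<in>vector_fields M. \<forall>f::'a \<Rightarrow> real. smooth_on M f \<longrightarrow> (\<forall>p\<in>M.
        nabla (\<lambda>x. f x *\<^sub>R X x) Y p = f p *\<^sub>R nabla X Y p \<and>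
        nabla X (\<lambda>x. f x *\<^sub>R Y x) p = mfd_deriv M f p (X p) *\<^sub>R Y p + f p *\<^sub>R nabla X Y p))"

text \<open>
  Torsion-freeness says that \<open>nabla X Y - nabla Y X\<close> acts on smooth functions as the commutator
  of the derivations \<open>X\<close> and \<open>Y\<close>.
\<close>

definition torsion_free ::
  "'a::euclidean_space set \<Rightarrow> (('a \<Rightarrow> 'a) \<Rightarrow> ('a \<Rightarrow> 'a) \<Rightarrow> 'a \<Rightarrow> 'a) \<Rightarrow> bool" where
  "torsion_free M nabla \<longleftrightarrow>
     (\<forall>X\<in>vector_fields M. \<forall>Y\<in>vector_fields M. \<forall>f::'a \<Rightarrow> real. smooth_on M f \<longrightarrow> (\<forall>p\<in>M.
        mfd_deriv M f p (nabla X Y p - nabla Y X p) =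
          mfd_deriv M (\<lambda>x. mfd_deriv M f x (Y x)) p (X p)
          - mfd_deriv M (\<lambda>x. mfd_deriv M f x (X x)) p (Y p)))"

definition metric_compatible ::
  "'a::euclidean_space set \<Rightarrow> ('a \<Rightarrow> 'a \<Rightarrow> 'a \<Rightarrow> real) \<Rightarrow>
     (('a \<Rightarrow> 'a) \<Rightarrow> ('a \<Rightarrow> 'a) \<Rightarrow> 'a \<Rightarrow> 'a) \<Rightarrow> bool" where
  "metric_compatible M g nabla \<longleftrightarrow>
     (\<forall>X\<in>vector_fields M. \<forall>Y\<in>vector_fields M. \<forall>Z\<in>vector_fields M. \<forall>p\<in>M.
        mfd_deriv M (\<lambda>x. g x (Y x) (Z x)) p (X p) =
          g p (nabla X Y p) (Z p) + g p (Y p) (nabla X Z p))"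

definition levi_civita_connection ::
  "'a::euclidean_space set \<Rightarrow> ('a \<Rightarrow> 'a \<Rightarrow> 'a \<Rightarrow> real) \<Rightarrow>
     (('a \<Rightarrow> 'a) \<Rightarrow> ('a \<Rightarrow> 'a) \<Rightarrow> 'a \<Rightarrow> 'a) \<Rightarrow> bool" where
  "levi_civita_connection M g nabla \<longleftrightarrow>
     affine_connection M nabla \<and> torsion_free M nabla \<and> metric_compatible M g nabla"

definition fields_along :: "'a::euclidean_space set \<Rightarrow> real set \<Rightarrow> (real \<Rightarrow> 'a) \<Rightarrow> (real \<Rightarrow> 'a) set" where
  "fields_along M J c = {V. smooth_on J V \<and> (\<forall>t\<in>J. V t \<in> tangent_space M (c t))}"

text \<open>
  The covariant derivative along \<open>c\<close> is the operator on vector fields along \<open>c\<close> that is additive,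
  satisfies the product rule and agrees with the connection on fields that extend to \<open>M\<close>.
\<close>

definition covariant_derivative_along ::
  "'a::euclidean_space set \<Rightarrow> (('a \<Rightarrow> 'a) \<Rightarrow> ('a \<Rightarrow> 'a) \<Rightarrow> 'a \<Rightarrow> 'a) \<Rightarrow> real set \<Rightarrow> (real \<Rightarrow> 'a) \<Rightarrow>
     ((real \<Rightarrow> 'a) \<Rightarrow> real \<Rightarrow> 'a) \<Rightarrow> bool" where
  "covariant_derivative_along M nabla J c D \<longleftrightarrow>
     (\<forall>V\<in>fields_along M J c. D V \<in> fields_along M J c) \<and>
     (\<forall>V\<in>fields_along M J c. \<forall>W\<in>fields_along M J c. \<forall>t\<in>J.
        D (\<lambda>s. V s + W s) t = D V t + D W t) \<and>
     (\<forall>V\<in>fields_along M J c. \<forall>f::real \<Rightarrow> real. smooth_on J f \<longrightarrow> (\<forall>t\<in>J.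
        D (\<lambda>s. f s *\<^sub>R V s) t = vector_derivative f (at t) *\<^sub>R V t + f t *\<^sub>R D V t)) \<and>
     (\<forall>V\<in>fields_along M J c. \<forall>X\<in>vector_fields M. \<forall>Y\<in>vector_fields M. \<forall>t\<in>J.
        X (c t) = vector_derivative c (at t) \<and> (\<forall>s\<in>J. V s = Y (c s))
        \<longrightarrow> D V t = nabla X Y (c t))"

definition geodesic_on ::
  "'a::euclidean_space set \<Rightarrow> (('a \<Rightarrow> 'a) \<Rightarrow> ('a \<Rightarrow> 'a) \<Rightarrow> 'a \<Rightarrow> 'a) \<Rightarrow> real set \<Rightarrow> (real \<Rightarrow> 'a) \<Rightarrow> bool" where
  "geodesic_on M nabla J c \<longleftrightarrow>
     open J \<and> is_interval J \<and> smooth_on J c \<and> c ` J \<subseteq> M \<and>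
     (\<exists>D. covariant_derivative_along M nabla J c D \<and>
          (\<forall>t\<in>J. D (\<lambda>s. vector_derivative c (at s)) t = 0))"


section \<open>Quotient metrics\<close>

text \<open>
  If \<open>f\<close> is a surjective submersion of \<open>(M, g)\<close> onto \<open>N\<close> whose fibres are the orbits of a group of
  isometries, then \<open>quotient_metric M g f\<close> is the metric on \<open>N\<close> obtained from the quotient metric on
  the orbit space: the differential of \<open>f\<close> is isometric on the orthogonal complement of the tangent
  space of the fibre.
\<close>

definition horizontal_space ::
  "'a::euclidean_space set \<Rightarrow> ('a \<Rightarrow> 'a \<Rightarrow> 'a \<Rightarrow> real) \<Rightarrow> ('a \<Rightarrow> 'b) \<Rightarrow> 'a \<Rightarrow> 'a set" where
  "horizontal_space M g f Q =
     {\<xi> \<in> tangent_space M Q. \<forall>\<eta>\<in>tangent_space {R\<in>M. f R = f Q} Q. g Q \<xi> \<eta> = 0}"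

definition quotient_metric ::
  "'a::euclidean_space set \<Rightarrow> ('a \<Rightarrow> 'a \<Rightarrow> 'a \<Rightarrow> real) \<Rightarrow> ('a \<Rightarrow> 'b::real_normed_vector) \<Rightarrow>
     'b \<Rightarrow> 'b \<Rightarrow> 'b \<Rightarrow> real" where
  "quotient_metric M g f p u v =
     (THE s. \<forall>Q\<in>M. \<forall>\<xi>\<in>horizontal_space M g f Q. \<forall>\<eta>\<in>horizontal_space M g f Q.
        f Q = p \<and> mfd_deriv M f Q \<xi> = u \<and> mfd_deriv M f Q \<eta> = v \<longrightarrow> s = g Q \<xi> \<eta>)"


section \<open>Flag manifolds\<close>

type_synonym ('n, 'r) matrix_tuple = "(((real, 'n) vec, 'n) vec, 'r) vec"

definition commutator :: "real^'n^'n \<Rightarrow> real^'n^'n \<Rightarrow> real^'n^'n" where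
  "commutator A B = A ** B - B ** A"

definition so_algebra :: "(real^'n^'n) set" where
  "so_algebra = {A. transpose A = - A}"

definition SO_group :: "(real^'n^'n) set" where
  "SO_group = {Q. rotation_matrix Q}"

text \<open>
  Tangent vectors of \<open>SO(n)\<close> at \<open>Q\<close> have the form \<open>Q ** \<Omega>\<close>, where \<open>\<Omega> = transpose Q ** \<xi>\<close>.
\<close>

definition SO_metric :: "real^'n^'n \<Rightarrow> real^'n^'n \<Rightarrow> real^'n^'n \<Rightarrow> real" where
  "SO_metric Q \<xi> \<eta> = trace (transpose (transpose Q ** \<xi>) ** (transpose Q ** \<eta>)) / 2"

definition grassmannian :: "nat \<Rightarrow> (real^'n^'n) set" where
  "grassmannian k = {P. P ** P = P \<and> transpose P = P \<and> rank P = k}"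

definition flag_manifold :: "('r::finite \<Rightarrow> nat) \<Rightarrow> (real^'n^'n^'r) set" where
  "flag_manifold q =
     {P. (\<forall>i. P $ i \<in> grassmannian (q i)) \<and> (\<forall>i j. i \<noteq> j \<longrightarrow> P $ i ** P $ j = 0)}"

definition flag_action :: "real^'n^'n \<Rightarrow> real^'n^'n^'r \<Rightarrow> real^'n^'n^'r" where
  "flag_action Q P = (\<chi> i. Q ** P $ i ** transpose Q)"

text \<open>
  The linear orders on the index types \<open>'n\<close> and \<open>'r\<close> identify them with \<open>{0..<n}\<close> and \<open>{0..<r}\<close>;
  the position of \<open>a\<close> is the number of smaller indices.
\<close>

definition standard_flag ::
  "('r::{finite,linorder} \<Rightarrow> nat) \<Rightarrow> ('n::{finite,linorder}, 'r) matrix_tuple" where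
  "standard_flag q = (\<chi> i a b.
     if a = b \<and> card {c. c < a} \<in> {(\<Sum>l | l < i. q l) ..< (\<Sum>l | l \<le> i. q l)} then 1 else 0)"

text \<open>
  The fibres of \<open>Q \<mapsto> flag_action Q (standard_flag q)\<close> on \<open>SO(n)\<close> are the cosets of the isotropy
  group of the standard flag.
\<close>

definition flag_metric ::
  "('r::{finite,linorder} \<Rightarrow> nat) \<Rightarrow> ('n::{finite,linorder}, 'r) matrix_tuple \<Rightarrow>
     ('n, 'r) matrix_tuple \<Rightarrow> ('n, 'r) matrix_tuple \<Rightarrow> real" where
  "flag_metric q =
     quotient_metric SO_group SO_metric (\<lambda>Q. flag_action Q (standard_flag q))"

definition Omega_deriv ::
  "(real^'n^'n^'r \<Rightarrow> real^'n^'n^'r) \<Rightarrow> (real \<Rightarrow> real^'n^'n^'r) \<Rightarrow> real^'n^'n" where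
  "Omega_deriv Y \<Gamma> =
     (1/2) *\<^sub>R vector_derivative (\<lambda>t. \<Sum>j\<in>UNIV. commutator (Y (\<Gamma> t) $ j) (\<Gamma> t $ j)) (at 0)"

definition Omega_bracket ::
  "(real^'n^'n^'r \<Rightarrow> real^'n^'n^'r) \<Rightarrow> (real^'n^'n^'r \<Rightarrow> real^'n^'n^'r) \<Rightarrow> real^'n^'n^'r \<Rightarrow> real^'n^'n"
  where
  "Omega_bracket X Y \<beta> =
     (\<Sum>i\<in>UNIV. \<Sum>j\<in>UNIV. commutator (commutator (X \<beta> $ i) (\<beta> $ i)) (commutator (Y \<beta> $ j) (\<beta> $ j)))"

end

theory Submission
  imports Defs
begin

text \<open>
  A tangent vector \<open>v\<close> at a flag \<open>p\<close> has a unique horizontal lift, the skew matrix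
  \<open>\<omega> = (1/2) \<Sum>\<^sub>j [v\<^sub>j, p\<^sub>j]\<close>, characterised by \<open>v\<^sub>i = [\<omega>, p\<^sub>i]\<close> and \<open>p\<^sub>i \<omega> p\<^sub>i = 0\<close>, and the metric is half
  the Frobenius inner product of lifts. In terms of the lifts \<open>\<omega>\<^sub>X, \<omega>\<^sub>Y\<close> of vector fields put
  \<open>D X Y = [X(\<omega>\<^sub>Y) - (1/2)[\<omega>\<^sub>X, \<omega>\<^sub>Y], p\<^sub>i]\<^sub>i\<close>. The Jacobi identity makes \<open>D\<close> torsion-free, and ad-invariance
  of the inner product makes it metric, so it agrees with every Levi-Civita connection. Since
  \<open>\<Sum>\<^sub>i\<^sub>,\<^sub>j [[X\<^sub>i, p\<^sub>i], [Y\<^sub>j, p\<^sub>j]] = 4 [\<omega>\<^sub>X, \<omega>\<^sub>Y]\<close>, this is the formula of the theorem. Of the geodesic only its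
  velocity at \<open>0\<close> matters.
\<close>

section \<open>Matrix algebra\<close>

lemma bounded_bilinear_matrix_mult:
  "bounded_bilinear ((**) :: real^'n^'n \<Rightarrow> real^'n^'n \<Rightarrow> real^'n^'n)"
  unfolding bilinear_conv_bounded_bilinear[symmetric] bilinear_def linear_iff
  by (simp add: matrix_matrix_mult_def vec_eq_iff sum.distrib sum_distrib_left algebra_simps)

interpretation matmul: bounded_bilinear "(**) :: real^'n^'n \<Rightarrow> real^'n^'n \<Rightarrow> real^'n^'n"
  by (rule bounded_bilinear_matrix_mult)

interpretation commutator: bounded_bilinear "commutator :: real^'n^'n \<Rightarrow> real^'n^'n \<Rightarrow> real^'n^'n"
  unfolding bilinear_conv_bounded_bilinear[symmetric] bilinear_def linear_iff commutator_def
  by (simp add: matmul.add_left matmul.add_right matmul.scaleR_left matmul.scaleR_right algebra_simps)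

lemma bounded_linear_transpose: "bounded_linear (transpose :: real^'n^'n \<Rightarrow> real^'n^'n)"
  unfolding linear_conv_bounded_linear[symmetric] linear_iff
  by (simp add: transpose_def vec_eq_iff)

lemmas transpose_simps =
  linear_0[OF bounded_linear.linear[OF bounded_linear_transpose]]
  linear_add[OF bounded_linear.linear[OF bounded_linear_transpose]]
  linear_diff[OF bounded_linear.linear[OF bounded_linear_transpose]]
  linear_neg[OF bounded_linear.linear[OF bounded_linear_transpose]]
  transpose_scalar matrix_transpose_mul

lemmas matmul_distribs =
  matmul.add_left matmul.add_right matmul.diff_left matmul.diff_right matmul.minus_left matmul.minus_right

text \<open>The inner product of the nested vector type is the Frobenius product, so the trace form
  in \<open>SO_metric\<close> can be handled with the library facts on \<open>inner\<close>.\<close>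

lemma trace_transpose_mult: "trace (transpose A ** B) = A \<bullet> (B :: real^'n^'n)"
  unfolding trace_def transpose_def matrix_matrix_mult_def inner_vec_def
  by simp (rule sum.swap)

lemma inner_matmul_left: "((A :: real^'n^'n) ** B) \<bullet> C = (B :: real^'n^'n) \<bullet> (transpose A ** C)"
  unfolding trace_transpose_mult[symmetric] matrix_transpose_mul matrix_mul_assoc ..

lemma inner_transpose: "transpose A \<bullet> transpose B = A \<bullet> (B :: real^'n^'n)"
  unfolding inner_vec_def transpose_def by simp (rule sum.swap)

lemma inner_matmul_right: "((B :: real^'n^'n) ** (A :: real^'n^'n)) \<bullet> C = (B :: real^'n^'n) \<bullet> (C ** transpose A)"
  using inner_matmul_left[of "transpose A" "transpose B" "transpose C"]
  by (metis inner_transpose matrix_transpose_mul transpose_transpose)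

text \<open>Ad-invariance of the Frobenius product: multiplication by \<open>A\<close> on either
  side has multiplication by \<open>transpose A = - A\<close> as its adjoint. Compatibility with the
  metric comes down to this.\<close>

lemma inner_skew_commutator:
  "A \<in> so_algebra \<Longrightarrow> commutator A B \<bullet> C = - (B \<bullet> commutator A C)"
  using inner_matmul_left[of A B C] inner_matmul_right[of B A C]
  by (simp add: so_algebra_def commutator_def inner_diff_left inner_diff_right matmul_distribs)

lemma so_algebra_commutator:
  "A \<in> so_algebra \<Longrightarrow> B \<in> so_algebra \<Longrightarrow> commutator A B \<in> so_algebra"
  by (simp add: so_algebra_def commutator_def transpose_simps matmul_distribs)

lemma subspace_so_algebra: "subspace so_algebra"
  unfolding subspace_def so_algebra_def by (simp add: transpose_simps)

lemma commutator_Jacobi: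
  "commutator A (commutator B C) - commutator B (commutator A C) = commutator (commutator A B) C"
  by (simp add: commutator_def matmul_distribs matrix_mul_assoc)

section \<open>Smooth maps and derivatives along curves\<close>

lemma smooth_on_subset:
  assumes "smooth_on M f" "N \<subseteq> M" shows "smooth_on N f"
  unfolding smooth_on_def
proof
  fix p assume "p \<in> N"
  then have "p \<in> M" using assms(2) by blast
  then obtain U h where "open U" "p \<in> U" "\<forall>k. Ck_on k U h" "\<forall>x\<in>U \<inter> M. h x = f x"
    using assms(1) unfolding smooth_on_def by blast
  then show "\<exists>U h. open U \<and> p \<in> U \<and> (\<forall>k. Ck_on k U h) \<and> (\<forall>x\<in>U \<inter> N. h x = f x)"
    using assms(2) by (intro exI[of _ U] exI[of _ h]) auto
qed

lemma Ck_on_const: "Ck_on k U (\<lambda>x. c)"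
  by (induction k arbitrary: c) (simp_all)

lemma Ck_on_bounded_linear:
  assumes "bounded_linear f" shows "Ck_on k U f"
proof (cases k)
  case 0
  then show ?thesis by (simp add: assms linear_continuous_on)
next
  case (Suc l)
  have "(f has_derivative f) (at x)" for x
    using assms by (rule bounded_linear_imp_has_derivative)
  then have "frechet_derivative f (at x) = f" "f differentiable (at x)" for x
    by (metis frechet_derivative_at, metis differentiableI)
  then show ?thesis by (simp add: Suc Ck_on_const)
qed

lemma smooth_on_bounded_linear: "bounded_linear f \<Longrightarrow> smooth_on M f"
  unfolding smooth_on_def by (intro ballI exI[of _ UNIV] exI[of _ f]) (simp add: Ck_on_bounded_linear)

text \<open>Every derivative of a linear image of a solution is again a linear image of it, so the
  induction runs over all linear \<open>B\<close> at once. This gives smoothness of one-parameter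
  orbits without differentiating a power series repeatedly.\<close>

lemma smooth_on_linear_ode:
  fixes c :: "real \<Rightarrow> 'a::euclidean_space"
  assumes "bounded_linear L" and c: "\<And>t. (c has_vector_derivative L (c t)) (at t)"
  shows "smooth_on S c"
proof -
  have "Ck_on k UNIV (\<lambda>t. B (c t))" if "bounded_linear B" for k and B :: "'a \<Rightarrow> 'a"
    using that
  proof (induction k arbitrary: B)
    case 0
    have "isCont c t" for t
      using c has_vector_derivative_continuous by blast
    then show ?case
      by (auto intro!: continuous_at_imp_continuous_on bounded_linear.isCont[OF 0])
  next
    case (Suc k)
    have d: "((\<lambda>t. B (c t)) has_derivative (\<lambda>v. v *\<^sub>R B (L (c t)))) (at t)" for t
      using bounded_linear.has_vector_derivative[OF Suc.prems c] by (simp add: has_vector_derivative_def)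
    then have "frechet_derivative (\<lambda>t. B (c t)) (at t) = (\<lambda>v. v *\<^sub>R B (L (c t)))" for t
      by (metis frechet_derivative_at)
    moreover have "bounded_linear (\<lambda>x. v *\<^sub>R B (L x))" for v
      by (intro bounded_linear_const_scaleR bounded_linear_compose[OF Suc.prems] assms(1))
    ultimately show ?case using d Suc.IH by (auto intro: differentiableI)
  qed
  from this[OF bounded_linear_ident] show ?thesis
    unfolding smooth_on_def by (intro ballI exI[of _ UNIV] exI[of _ c]) auto
qed

text \<open>Relational form of \<open>mfd_deriv\<close>. It avoids the definite description, so
  linear and product rules hold for every \<open>v\<close>; tangency of \<open>v\<close> enters only
  for uniqueness, since the relation is vacuous when no curve has velocity \<open>v\<close>.\<close>

definition has_mfd_deriv ::
  "'a::euclidean_space set \<Rightarrow> ('a \<Rightarrow> 'b::real_normed_vector) \<Rightarrow> 'a \<Rightarrow> 'a \<Rightarrow> 'b \<Rightarrow> bool" where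
  "has_mfd_deriv M f p v w \<longleftrightarrow> (\<forall>c. curve_through M p v c \<longrightarrow> ((f \<circ> c) has_vector_derivative w) (at 0))"

lemma mfd_deriv_eq:
  assumes "v \<in> tangent_space M p" "has_mfd_deriv M f p v w"
  shows "mfd_deriv M f p v = w"
  unfolding mfd_deriv_def
proof (rule the_equality)
  show "\<forall>c. curve_through M p v c \<longrightarrow> ((f \<circ> c) has_vector_derivative w) (at 0)"
    using assms(2) by (simp add: has_mfd_deriv_def)
  fix w' assume w': "\<forall>c. curve_through M p v c \<longrightarrow> ((f \<circ> c) has_vector_derivative w') (at 0)"
  obtain c where "curve_through M p v c" using assms(1) by (auto simp: tangent_space_def)
  then show "w' = w" using w' assms(2) unfolding has_mfd_deriv_def
    by (metis vector_derivative_at)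
qed

lemma has_mfd_deriv_unique:
  assumes "v \<in> tangent_space M p" "has_mfd_deriv M f p v w" "has_mfd_deriv M f p v w'"
  shows "w = w'"
  using mfd_deriv_eq[OF assms(1,2)] mfd_deriv_eq[OF assms(1,3)] by simp

lemma curve_throughD:
  assumes "curve_through M p v c"
  obtains e where "e > 0" "\<And>t. \<bar>t\<bar> < e \<Longrightarrow> c t \<in> M"
proof -
  obtain e where e: "e > 0" and sub: "c ` {-e<..<e} \<subseteq> M"
    using assms unfolding curve_through_def by blast
  have "c t \<in> M" if "\<bar>t\<bar> < e" for t
  proof -
    have "t \<in> {-e<..<e}" using that by auto
    with sub show ?thesis by blast
  qed
  with e show thesis by (rule that)
qed

lemma has_vector_derivative_cong_near:
  assumes "(f has_vector_derivative w) (at (0::real))" "e > 0" "\<And>t. \<bar>t\<bar> < e \<Longrightarrow> f t = g t"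
  shows "(g has_vector_derivative w) (at 0)"
  by (rule has_vector_derivative_transform_within_open[OF assms(1), of "{-e<..<e}"])
    (use assms in auto)

lemma has_mfd_deriv_cong:
  assumes "has_mfd_deriv M f p v w" "\<And>x. x \<in> M \<Longrightarrow> f x = g x"
  shows "has_mfd_deriv M g p v w"
  unfolding has_mfd_deriv_def
proof (intro allI impI)
  fix c assume c: "curve_through M p v c"
  obtain e where e: "e > 0" "\<And>t. \<bar>t\<bar> < e \<Longrightarrow> c t \<in> M" by (rule curve_throughD[OF c]) blast
  have "((f \<circ> c) has_vector_derivative w) (at 0)" using assms(1) c by (simp add: has_mfd_deriv_def)
  then show "((g \<circ> c) has_vector_derivative w) (at 0)"
    by (rule has_vector_derivative_cong_near[where e=e]) (simp_all add: e assms(2))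
qed

text \<open>The means of linearising: an equation that holds on all of \<open>M\<close> yields a
  linear equation for each tangent vector.\<close>

lemma has_mfd_deriv_const_on:
  assumes "has_mfd_deriv M f p v w" "v \<in> tangent_space M p" "\<And>x. x \<in> M \<Longrightarrow> f x = k"
  shows "w = 0"
proof -
  have "has_mfd_deriv M f p v 0"
    by (rule has_mfd_deriv_cong[of _ "\<lambda>x. k"]) (simp_all add: has_mfd_deriv_def assms(3) o_def)
  then show ?thesis by (rule has_mfd_deriv_unique[OF assms(2,1)])
qed

lemma curve_through_mono:
  assumes "curve_through N p v c" "N \<subseteq> M" shows "curve_through M p v c"
proof -
  obtain e where "e > 0" "smooth_on {-e<..<e} c" "c ` {-e<..<e} \<subseteq> N"
    using assms(1) unfolding curve_through_def by blast
  moreover from this have "c ` {-e<..<e} \<subseteq> M" using assms(2) by (rule_tac order_trans)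
  ultimately have "\<exists>e>0. smooth_on {-e<..<e} c \<and> c ` {-e<..<e} \<subseteq> M"
    by (intro exI[of _ e]) simp
  then show ?thesis using assms(1) unfolding curve_through_def by simp
qed

lemma tangent_space_mono: "N \<subseteq> M \<Longrightarrow> tangent_space N p \<subseteq> tangent_space M p"
  by (auto simp: tangent_space_def dest: curve_through_mono)

lemma has_mfd_deriv_ident: "has_mfd_deriv M (\<lambda>x. x) p v v"
  by (auto simp: has_mfd_deriv_def curve_through_def o_def)

lemma has_mfd_deriv_linear:
  assumes "bounded_linear L" "has_mfd_deriv M f p v w"
  shows "has_mfd_deriv M (\<lambda>x. L (f x)) p v (L w)"
  using assms by (auto simp: has_mfd_deriv_def o_def intro: bounded_linear.has_vector_derivative)

lemma has_mfd_deriv_bilinear: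
  assumes "bounded_bilinear B" "has_mfd_deriv M f p v w" "has_mfd_deriv M g p v z"
  shows "has_mfd_deriv M (\<lambda>x. B (f x) (g x)) p v (B (f p) z + B w (g p))"
  unfolding has_mfd_deriv_def
proof (intro allI impI)
  fix c assume c: "curve_through M p v c"
  then have "c 0 = p" by (simp add: curve_through_def)
  then show "((\<lambda>x. B (f x) (g x)) \<circ> c has_vector_derivative B (f p) z + B w (g p)) (at 0)"
    using bounded_bilinear.has_vector_derivative[OF assms(1), of "f \<circ> c" w 0 UNIV "g \<circ> c" z] assms(2,3) c
    by (simp add: has_mfd_deriv_def o_def)
qed

lemma smooth_on_has_mfd_deriv:
  assumes "smooth_on M f" "p \<in> M"
  obtains w where "has_mfd_deriv M f p v w"
proof -
  obtain U h where U: "open U" "p \<in> U" "\<forall>k. Ck_on k U h" "\<forall>x\<in>U \<inter> M. h x = f x"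
    using assms unfolding smooth_on_def by blast
  have "Ck_on (Suc 0) U h" using U by blast
  then have "h differentiable (at p)" using \<open>p \<in> U\<close> by simp
  then obtain D where D: "(h has_derivative D) (at p)" by (auto simp: differentiable_def)
  have "has_mfd_deriv M f p v (D v)"
    unfolding has_mfd_deriv_def
  proof (intro allI impI)
    fix c assume c: "curve_through M p v c"
    then obtain e where e: "e > 0" "\<And>t. \<bar>t\<bar> < e \<Longrightarrow> c t \<in> M" by (metis curve_throughD)
    have c0: "c 0 = p" and dc: "(c has_vector_derivative v) (at 0)" using c by (auto simp: curve_through_def)
    have "isCont c 0" using dc has_vector_derivative_continuous by blast
    \<comment> \<open>\<open>h\<close> agrees with \<open>f\<close> only on
      \<open>U \<inter> M\<close>, so near 0 the curve must be kept in \<open>U\<close> as well as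
      in \<open>M\<close>.\<close>
    then have "eventually (\<lambda>t. c t \<in> U) (nhds 0)"
      using U(1,2) c0 unfolding isCont_def tendsto_at_iff_tendsto_nhds by (auto intro: topological_tendstoD)
    then obtain e' where e': "e' > 0" "\<And>t. \<bar>t\<bar> < e' \<Longrightarrow> c t \<in> U"
      unfolding eventually_nhds_metric dist_real_def by auto
    have "((h \<circ> c) has_vector_derivative D v) (at 0)"
      using diff_chain_at[OF dc[unfolded has_vector_derivative_def], of h D] D c0
      by (simp add: has_vector_derivative_def o_def linear_cmul[OF has_derivative_linear[OF D]])
    then show "((f \<circ> c) has_vector_derivative D v) (at 0)"
      by (rule has_vector_derivative_cong_near[where e="min e e'"]) (use e e' U in auto)
  qed
  then show thesis by (rule that)
qed

lemma has_mfd_deriv_linear_constraint: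
  assumes "has_mfd_deriv M f p v w" "v \<in> tangent_space M p" "bounded_linear L"
    and "\<And>x. x \<in> M \<Longrightarrow> L (f x) = k"
  shows "L w = 0"
  using has_mfd_deriv_const_on[OF has_mfd_deriv_linear[OF assms(3,1)] assms(2)] assms(4) by blast

section \<open>The matrix exponential and the rotation group\<close>

definition matrix_power :: "real^'n^'n \<Rightarrow> nat \<Rightarrow> real^'n^'n" where
  "matrix_power A n = (((**) A) ^^ n) (mat 1)"

text \<open>The exponential of \<open>t *\<^sub>R A\<close>, given entrywise so that the theory of
  real power series applies to each entry.\<close>

definition matrix_exp :: "real^'n^'n \<Rightarrow> real \<Rightarrow> real^'n^'n" where
  "matrix_exp A t = (\<chi> i j. \<Sum>n. (matrix_power A n $ i $ j / fact n) * t ^ n)"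

lemma matrix_power_simps [simp]:
  "matrix_power A 0 = mat 1" "matrix_power A (Suc n) = A ** matrix_power A n"
  by (simp_all add: matrix_power_def)

text \<open>The sum of all absolute entries is a submultiplicative bound, so each entry of the
  exponential series is dominated by a scalar exponential series.\<close>

lemma abs_matrix_power_le:
  fixes A :: "real^'n^'n"
  shows "\<bar>matrix_power A n $ i $ j\<bar> \<le> (\<Sum>k\<in>UNIV. \<Sum>l\<in>UNIV. \<bar>A $ k $ l\<bar>) ^ n"
proof (induction n arbitrary: i)
  case 0
  show ?case by (simp add: mat_def)
next
  case (Suc n)
  let ?K = "\<Sum>k\<in>UNIV. \<Sum>l\<in>UNIV. \<bar>A $ k $ l\<bar>"
  have "\<bar>matrix_power A (Suc n) $ i $ j\<bar> \<le> (\<Sum>k\<in>UNIV. \<bar>A $ i $ k\<bar> * \<bar>matrix_power A n $ k $ j\<bar>)"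
    by (simp add: matrix_matrix_mult_def abs_mult[symmetric] sum_abs)
  also have "\<dots> \<le> (\<Sum>k\<in>UNIV. \<bar>A $ i $ k\<bar> * ?K ^ n)"
    by (intro sum_mono mult_left_mono Suc.IH) auto
  also have "\<dots> = (\<Sum>k\<in>UNIV. \<bar>A $ i $ k\<bar>) * ?K ^ n"
    by (simp add: sum_distrib_right)
  also have "\<dots> \<le> ?K * ?K ^ n"
    by (intro mult_right_mono member_le_sum[where f="\<lambda>k. \<Sum>l\<in>UNIV. \<bar>A $ k $ l\<bar>"] zero_le_power sum_nonneg) auto
  finally show ?case by simp
qed

lemma summable_matrix_exp: "summable (\<lambda>n. (matrix_power A n $ i $ j / fact n) * (t::real) ^ n)"
proof (rule summable_comparison_test')
  let ?K = "\<Sum>k\<in>UNIV. \<Sum>l\<in>UNIV. \<bar>A $ k $ l\<bar>"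
  show "summable (\<lambda>n. inverse (fact n) * (?K * \<bar>t\<bar>) ^ n)" by (rule summable_exp)
  show "norm ((matrix_power A n $ i $ j / fact n) * t ^ n) \<le> inverse (fact n) * (?K * \<bar>t\<bar>) ^ n" for n
    using mult_right_mono[OF abs_matrix_power_le[of A n i j], of "\<bar>t\<bar> ^ n / fact n"]
    by (simp add: abs_mult power_abs power_mult_distrib divide_inverse algebra_simps)
qed

lemma matrix_exp_0 [simp]: "matrix_exp A 0 = mat 1"
  unfolding matrix_exp_def powser_zero by (simp add: vec_eq_iff)

lemma matrix_expansion:
  fixes M :: "real^'n^'m"
  shows "M = (\<Sum>i\<in>UNIV. \<Sum>j\<in>UNIV. M $ i $ j *\<^sub>R axis i (axis j 1))"
proof -
  have "(\<Sum>j\<in>UNIV. M $ i $ j * (axis i (axis j 1) :: real^'n^'m) $ a $ b) = (if i = a then M $ a $ b else 0)" for i a b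
    by (cases "i = a") (simp_all add: axis_def if_distrib cong: if_cong)
  then show ?thesis by (simp add: vec_eq_iff)
qed

text \<open>Termwise differentiation of each entry; \<open>matrix_expansion\<close> then reassembles
  the entries into one vector derivative.\<close>

lemma matrix_exp_deriv: "(matrix_exp A has_vector_derivative A ** matrix_exp A t) (at t)"
proof -
  let ?c = "\<lambda>i j n. matrix_power A n $ i $ j / fact n"
  \<comment> \<open>The factor \<open>Suc n\<close> cancels against \<open>fact (Suc n)\<close>, and
    what remains of the shifted coefficient is one extra factor \<open>A\<close> on the
    left.\<close>
  have d: "diffs (?c i j) n = (\<Sum>k\<in>UNIV. A $ i $ k * ?c k j n)" for i j n
    by (simp add: diffs_def matrix_matrix_mult_def del: of_nat_Suc) (simp add: sum_divide_distrib)
  have "(\<Sum>n. diffs (?c i j) n * t ^ n) = (A ** matrix_exp A t) $ i $ j" for i j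
  proof -
    have "(\<Sum>n. diffs (?c i j) n * t ^ n) = (\<Sum>n. \<Sum>k\<in>UNIV. A $ i $ k * (?c k j n * t ^ n))"
      by (simp add: d sum_distrib_right mult.assoc)
    also have "\<dots> = (\<Sum>k\<in>UNIV. \<Sum>n. A $ i $ k * (?c k j n * t ^ n))"
      by (intro suminf_sum summable_mult summable_matrix_exp)
    also have "\<dots> = (A ** matrix_exp A t) $ i $ j"
      unfolding suminf_mult[OF summable_matrix_exp] by (simp add: matrix_matrix_mult_def matrix_exp_def)
    finally show ?thesis .
  qed
  then have "((\<lambda>t. \<Sum>n. ?c i j n * t ^ n) has_field_derivative (A ** matrix_exp A t) $ i $ j) (at t)" for i j
    using termdiffs_strong_converges_everywhere[OF summable_matrix_exp, of A i j t] by simp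
  then have "((\<lambda>t. (\<Sum>n. ?c i j n * t ^ n) *\<^sub>R axis i (axis j (1::real))) has_vector_derivative
      (A ** matrix_exp A t) $ i $ j *\<^sub>R axis i (axis j (1::real))) (at t)" for i j
    by (intro bounded_linear.has_vector_derivative[OF bounded_linear_scaleR_left])
      (simp add: has_real_derivative_iff_has_vector_derivative)
  then have "((\<lambda>t. \<Sum>i\<in>UNIV. \<Sum>j\<in>UNIV. matrix_exp A t $ i $ j *\<^sub>R axis i (axis j (1::real))) has_vector_derivative
      (\<Sum>i\<in>UNIV. \<Sum>j\<in>UNIV. (A ** matrix_exp A t) $ i $ j *\<^sub>R axis i (axis j (1::real)))) (at t)"
    by (intro has_vector_derivative_sum) (simp add: matrix_exp_def)
  moreover have "(\<lambda>t. \<Sum>i\<in>UNIV. \<Sum>j\<in>UNIV. matrix_exp A t $ i $ j *\<^sub>R axis i (axis j (1::real))) = matrix_exp A"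
    by (intro ext matrix_expansion[symmetric])
  ultimately show ?thesis using matrix_expansion[of "A ** matrix_exp A t"] by simp
qed

lemma matrix_exp_mult_deriv:
  fixes A B :: "real^'n^'n"
  shows "((\<lambda>t. matrix_exp A t ** B) has_vector_derivative A ** (matrix_exp A t ** B)) (at t)"
  using bounded_linear.has_vector_derivative[OF matmul.bounded_linear_left[of B] matrix_exp_deriv[of A t]]
  by (simp add: matrix_mul_assoc)

lemma has_vector_derivative_zero_eq:
  fixes f :: "real \<Rightarrow> 'a::real_normed_vector"
  assumes "\<And>t. (f has_vector_derivative 0) (at t)"
  shows "f t = f 0"
  using has_vector_derivative_zero_constant[of UNIV f] assms by (metis UNIV_I convex_UNIV)

text \<open>The defect \<open>S\<close> of commutation solves the linear equation S' = A S with S(0)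
  = 0. For skew \<open>A\<close> the flow preserves the norm, so \<open>S\<close> stays
  zero.\<close>

lemma matrix_exp_commute:
  assumes A: "A \<in> so_algebra" and AP: "A ** P = P ** A"
  shows "matrix_exp A t ** P = P ** matrix_exp A t"
proof -
  let ?S = "\<lambda>t. matrix_exp A t ** P - P ** matrix_exp A t"
  have "((\<lambda>t. P ** matrix_exp A t) has_vector_derivative P ** (A ** matrix_exp A t)) (at t)" for t
    by (rule bounded_linear.has_vector_derivative[OF matmul.bounded_linear_right matrix_exp_deriv])
  then have S: "(?S has_vector_derivative A ** ?S t) (at t)" for t
    using has_vector_derivative_diff[OF matrix_exp_mult_deriv[of A P t]]
    by (simp add: matmul_distribs matrix_mul_assoc AP)
  have "(A ** ?S t) \<bullet> ?S t = 0" for t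
    using inner_matmul_left[of A "?S t" "?S t"] A
    by (simp add: so_algebra_def matmul.minus_left inner_commute)
  then have "((\<lambda>t. ?S t \<bullet> ?S t) has_vector_derivative 0) (at t)" for t
    using bounded_bilinear.has_vector_derivative[OF bounded_bilinear_inner S[of t] S[of t]]
    by (simp add: inner_commute)
  from has_vector_derivative_zero_eq[OF this, of t] show ?thesis by simp
qed

section \<open>The rotation group: one-parameter subgroups and tangent spaces\<close>

lemma SO_groupD:
  assumes "Q \<in> SO_group"
  shows "transpose Q ** Q = mat 1" "Q ** transpose Q = mat 1" "det Q = 1"
  using assms by (auto simp: SO_group_def rotation_matrix_def orthogonal_matrix_def)

lemma SO_groupI: "transpose Q ** Q = mat 1 \<Longrightarrow> det Q = 1 \<Longrightarrow> Q \<in> SO_group"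
  by (simp add: SO_group_def rotation_matrix_def orthogonal_matrix)

lemma SO_group_mult: "Q \<in> SO_group \<Longrightarrow> R \<in> SO_group \<Longrightarrow> Q ** R \<in> SO_group"
  by (simp add: SO_group_def rotation_matrix_def orthogonal_matrix_mul det_mul)

text \<open>Orthogonality holds because \<open>transpose R ** R\<close> has derivative zero. The
  determinant is then continuous with values in {1, -1}, hence constantly equal to its value 1 at
  time 0.\<close>

lemma matrix_exp_in_SO:
  assumes A: "A \<in> so_algebra"
  shows "matrix_exp A t \<in> SO_group"
proof -
  let ?R = "matrix_exp A"
  have "((\<lambda>t. transpose (?R t)) has_vector_derivative transpose (A ** ?R t)) (at t)" for t
    by (rule bounded_linear.has_vector_derivative[OF bounded_linear_transpose matrix_exp_deriv])
  from matmul.has_vector_derivative[OF this matrix_exp_deriv[of A]]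
  have "((\<lambda>t. transpose (?R t) ** ?R t) has_vector_derivative 0) (at t)" for t
    using A by (simp add: transpose_simps so_algebra_def matmul_distribs matrix_mul_assoc)
  from has_vector_derivative_zero_eq[OF this]
  have orth: "transpose (?R t) ** ?R t = mat 1" for t by simp
  have "isCont ?R t" for t using matrix_exp_deriv has_vector_derivative_continuous by blast
  then have "continuous_on UNIV ?R" by (simp add: continuous_at_imp_continuous_on)
  then have cont: "continuous_on UNIV (\<lambda>t. det (?R t))"
    unfolding det_def by (intro continuous_intros)
  have "det (?R t) \<in> {1, -1}" for t
    using orth det_orthogonal_matrix[of "?R t"] by (auto simp: orthogonal_matrix)
  then have "finite (range (\<lambda>t. det (?R t)))" by (meson finite.emptyI finite.insertI finite_subset image_subsetI)
  then have "(\<lambda>t. det (?R t)) constant_on UNIV"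
    using cont by (intro continuous_finite_range_constant) auto
  then have "det (?R t) = det (?R 0)" unfolding constant_on_def by (metis UNIV_I)
  then show ?thesis using orth by (intro SO_groupI) auto
qed

text \<open>Tangent vectors at \<open>Q\<close> are written \<open>A ** Q\<close> here, not
  \<open>Q ** \<Omega>\<close>: the factor \<open>A\<close> is then the infinitesimal rotation
  acting on the flag to which \<open>Q\<close> moves the base flag.\<close>

lemma curve_through_SO:
  assumes "A \<in> so_algebra" "Q \<in> SO_group"
  shows "curve_through SO_group Q (A ** Q) (\<lambda>t. matrix_exp A t ** Q)"
  unfolding curve_through_def
proof (intro conjI exI[of _ 1])
  show "smooth_on {-1<..<1} (\<lambda>t. matrix_exp A t ** Q)"
    by (rule smooth_on_linear_ode[OF matmul.bounded_linear_right matrix_exp_mult_deriv])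
  show "((\<lambda>t. matrix_exp A t ** Q) has_vector_derivative A ** Q) (at 0)"
    using matrix_exp_mult_deriv[of A Q 0] by simp
qed (use assms matrix_exp_in_SO in \<open>auto intro: SO_group_mult\<close>)

lemma tangent_space_SO:
  assumes \<xi>: "\<xi> \<in> tangent_space SO_group Q" and Q: "Q \<in> SO_group"
  obtains B where "B \<in> so_algebra" "\<xi> = B ** Q"
proof
  \<comment> \<open>Differentiating \<open>Q ** transpose Q = mat 1\<close> shows that
    \<open>\<xi> ** transpose Q\<close> is skew.\<close>
  have "has_mfd_deriv SO_group (\<lambda>x. x ** transpose x) Q \<xi> (Q ** transpose \<xi> + \<xi> ** transpose Q)"
    by (rule has_mfd_deriv_bilinear[OF bounded_bilinear_matrix_mult has_mfd_deriv_ident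
          has_mfd_deriv_linear[OF bounded_linear_transpose has_mfd_deriv_ident]])
  from has_mfd_deriv_const_on[OF this \<xi>, of "mat 1"]
  have "Q ** transpose \<xi> + \<xi> ** transpose Q = 0" using SO_groupD by blast
  then show "\<xi> ** transpose Q \<in> so_algebra"
    by (simp add: so_algebra_def transpose_simps add_eq_0_iff2)
  show "\<xi> = \<xi> ** transpose Q ** Q"
    using SO_groupD[OF Q] by (simp add: matrix_mul_assoc[symmetric])
qed

section \<open>Infinitesimal rotations of a flag\<close>

text \<open>The fundamental vector field of the action by conjugation, that is, the velocity at time
  0 of the rotations exp(tA) applied to \<open>P\<close> for skew \<open>A\<close>.\<close>

definition inf_rotation :: "real^'n^'n \<Rightarrow> real^'n^'n^'r \<Rightarrow> real^'n^'n^'r" where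
  "inf_rotation A P = (\<chi> i. commutator A (P $ i))"

text \<open>For a complete system of orthogonal projections \<open>P\<close>, this is the orthogonal
  projection onto the matrices commuting with every \<open>P $ i\<close>. On skew matrices it
  extracts the vertical part, the one in the isotropy algebra of \<open>P\<close>.\<close>

definition block_diag :: "real^'n^'n^'r::finite \<Rightarrow> real^'n^'n \<Rightarrow> real^'n^'n" where
  "block_diag P A = (\<Sum>i\<in>UNIV. P $ i ** A ** P $ i)"

text \<open>Defined for all tuples and bilinear in base point and vector, so that the product rule
  applies when both vary.\<close>

definition flag_lift :: "real^'n^'n^'r::finite \<Rightarrow> real^'n^'n^'r \<Rightarrow> real^'n^'n" where
  "flag_lift P V = (1/2) *\<^sub>R (\<Sum>j\<in>UNIV. commutator (V $ j) (P $ j))"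

lemma inf_rotation_nth [simp]: "inf_rotation A P $ i = commutator A (P $ i)"
  by (simp add: inf_rotation_def)

lemma bounded_bilinear_inf_rotation: 
  "bounded_bilinear (inf_rotation :: real^'n^'n \<Rightarrow> real^'n^'n^'r::finite \<Rightarrow> _)"
  unfolding bilinear_conv_bounded_bilinear[symmetric] bilinear_def linear_iff
  by (simp add: vec_eq_iff[where 'b='r] commutator.add_left commutator.add_right
      commutator.scaleR_left commutator.scaleR_right)

interpretation inf_rotation: bounded_bilinear "inf_rotation :: real^'n^'n \<Rightarrow> real^'n^'n^'r::finite \<Rightarrow> _"
  by (rule bounded_bilinear_inf_rotation)

lemma bounded_bilinear_flag_lift:
  "bounded_bilinear (flag_lift :: real^'n^'n^'r::finite \<Rightarrow> real^'n^'n^'r \<Rightarrow> _)"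
  unfolding bilinear_conv_bounded_bilinear[symmetric] bilinear_def linear_iff
  by (simp add: flag_lift_def commutator.add_left commutator.add_right sum.distrib scaleR_add_right
      commutator.scaleR_left commutator.scaleR_right scaleR_sum_right)

interpretation flag_lift: bounded_bilinear "flag_lift :: real^'n^'n^'r::finite \<Rightarrow> real^'n^'n^'r \<Rightarrow> _"
  by (rule bounded_bilinear_flag_lift)

lemma flag_lift_skew:
  assumes "\<And>i. transpose (P $ i) = P $ i" "\<And>i. transpose (V $ i) = V $ i"
  shows "flag_lift P V \<in> so_algebra"
proof -
  have "commutator (V $ j) (P $ j) \<in> so_algebra" for j
    by (simp add: so_algebra_def commutator_def transpose_simps assms)
  then show ?thesis
    unfolding flag_lift_def by (intro subspace_scale subspace_sum subspace_so_algebra)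
qed

section \<open>Algebra of a complete system of mutually orthogonal projections\<close>

locale flag_projections =
  fixes P :: "real^'n^'n^'r::finite"
  assumes idem: "P $ i ** P $ i = P $ i"
    and symm: "transpose (P $ i) = P $ i"
    and orth: "i \<noteq> j \<Longrightarrow> P $ i ** P $ j = 0"
    and sum_id: "(\<Sum>i\<in>UNIV. P $ i) = mat 1"
begin

lemma prod: "P $ i ** P $ j = (if i = j then P $ i else 0)"
  by (simp add: idem orth)

lemma prod': "A ** P $ i ** P $ j = (if i = j then A ** P $ i else 0)"
  by (simp add: prod matrix_mul_assoc[symmetric])

lemma block_diag_mult: "block_diag P A ** P $ i = P $ i ** A ** P $ i"
  "P $ i ** block_diag P A = P $ i ** A ** P $ i"
proof -
  show "block_diag P A ** P $ i = P $ i ** A ** P $ i"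
    by (simp add: block_diag_def matmul.sum_left prod' sum.delta cong: if_cong)
  have "P $ i ** (P $ j ** A ** P $ j) = (if j = i then P $ i ** A ** P $ i else 0)" for j
    by (simp add: matrix_mul_assoc prod)
  then show "P $ i ** block_diag P A = P $ i ** A ** P $ i"
    by (simp add: block_diag_def matmul.sum_right)
qed

lemma block_diag_idem: "block_diag P (block_diag P A) = block_diag P A"
  by (simp add: block_diag_def[of P "block_diag P A"] block_diag_mult prod')
    (simp add: block_diag_def)

lemma inner_block_diag: "block_diag P A \<bullet> B = A \<bullet> block_diag P B"
proof -
  have "(P $ i ** A ** P $ i) \<bullet> B = A \<bullet> (P $ i ** B ** P $ i)" for i
    by (simp add: inner_matmul_right[of "P $ i ** A"] inner_matmul_left[of "P $ i" A] symm matrix_mul_assoc)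
  then show ?thesis by (simp add: block_diag_def inner_sum_left inner_sum_right)
qed

lemma block_diag_skew: "A \<in> so_algebra \<Longrightarrow> block_diag P A \<in> so_algebra"
  unfolding block_diag_def
  by (intro subspace_sum subspace_so_algebra)
    (simp add: so_algebra_def transpose_simps symm matmul_distribs matrix_mul_assoc)

text \<open>Each double commutator is AP + PA - 2PAP; summed over the projections, which add up to
  the identity, this is 2A minus twice the block diagonal part. Lifting an infinitesimal rotation
  thus removes exactly its vertical part.\<close>

lemma flag_lift_inf_rotation: "flag_lift P (inf_rotation A P) = A - block_diag P A"
proof -
  have "commutator (commutator A (P $ j)) (P $ j) = A ** P $ j + P $ j ** A - 2 *\<^sub>R (P $ j ** A ** P $ j)" for j
    by (simp add: commutator_def matmul_distribs matrix_mul_assoc prod' prod scaleR_2)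
  then have "flag_lift P (inf_rotation A P) = (1/2) *\<^sub>R (A ** (\<Sum>j\<in>UNIV. P $ j) + (\<Sum>j\<in>UNIV. P $ j) ** A - 2 *\<^sub>R block_diag P A)"
    by (simp add: flag_lift_def block_diag_def matmul.sum_left matmul.sum_right sum.distrib
        sum_subtractf scaleR_sum_right)
  then show ?thesis by (simp add: sum_id scaleR_diff_right scaleR_2[symmetric])
qed

lemma block_diag_eq_0_if_fixed:
  assumes "inf_rotation H P = 0" shows "block_diag P H = H"
  using flag_lift_inf_rotation[of H] by (simp add: assms flag_lift.zero_right)

text \<open>The hypotheses are the linearised equations of the flag manifold.\<close>

lemma inf_rotation_flag_lift:
  assumes idem': "\<And>i. P $ i ** V $ i + V $ i ** P $ i = V $ i"
    and orth': "\<And>i j. i \<noteq> j \<Longrightarrow> P $ i ** V $ j + V $ i ** P $ j = 0"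
    and sum': "(\<Sum>i\<in>UNIV. V $ i) = 0"
  shows "inf_rotation (flag_lift P V) P = V"
proof -
  \<comment> \<open>Sandwiching \<open>V $ i = P $ i ** V $ i + V $ i ** P $ i\<close> between two
    copies of \<open>P $ i\<close> gives PVP = 2 PVP.\<close>
  have PVP: "P $ i ** V $ i ** P $ i = 0" for i
  proof -
    have "P $ i ** (P $ i ** V $ i + V $ i ** P $ i) ** P $ i = P $ i ** V $ i ** P $ i"
      by (simp add: idem')
    then show ?thesis by (simp add: matmul_distribs matrix_mul_assoc idem prod')
  qed
  have 1: "commutator (V $ j) (P $ j) ** P $ i = (if j = i then V $ i ** P $ i else - (P $ j ** V $ j ** P $ i))" for i j
    using PVP by (simp add: commutator_def matmul_distribs prod')
  have 2: "- (P $ j ** V $ j ** P $ i) = P $ j ** V $ i" if "j \<noteq> i" for i j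
  proof -
    have "P $ j ** (P $ j ** V $ i + V $ j ** P $ i) = 0" using orth'[OF that] by simp
    then show ?thesis
      by (simp add: matmul_distribs matrix_mul_assoc idem add_eq_0_iff2)
  qed
  have 3: "(\<Sum>j\<in>UNIV. commutator (V $ j) (P $ j)) ** P $ i = 2 *\<^sub>R (V $ i ** P $ i)" for i
  proof -
    \<comment> \<open>Every summand with \<open>j \<noteq> i\<close> equals
      \<open>P $ j ** V $ i\<close>. The summand \<open>j = i\<close> is brought to the same form
      plus a correction, so that completeness of the projections evaluates the sum.\<close>
    have "(\<Sum>j\<in>UNIV. commutator (V $ j) (P $ j)) ** P $ i =
        (\<Sum>j\<in>UNIV. P $ j ** V $ i + (if j = i then V $ i ** P $ i - P $ i ** V $ i else 0))"
      unfolding matmul.sum_left by (rule sum.cong) (auto simp: 1 2)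
    also have "\<dots> = (\<Sum>j\<in>UNIV. P $ j) ** V $ i + (V $ i ** P $ i - P $ i ** V $ i)"
      by (simp add: sum.distrib matmul.sum_left)
    also have "\<dots> = (P $ i ** V $ i + V $ i ** P $ i) + (V $ i ** P $ i - P $ i ** V $ i)"
      by (simp add: sum_id idem')
    finally show ?thesis by (simp add: scaleR_2)
  qed
  have 4: "P $ i ** commutator (V $ j) (P $ j) = (if j = i then - (P $ i ** V $ i) else P $ i ** V $ j ** P $ j)" for i j
    using PVP by (simp add: commutator_def matmul_distribs matrix_mul_assoc prod)
  have 5: "P $ i ** V $ j ** P $ j = - (V $ i ** P $ j)" if "j \<noteq> i" for i j
  proof -
    have "(P $ i ** V $ j + V $ i ** P $ j) ** P $ j = 0" using orth'[of i j] that by simp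
    then show ?thesis
      by (simp add: matmul_distribs prod' add_eq_0_iff2)
  qed
  have 6: "P $ i ** (\<Sum>j\<in>UNIV. commutator (V $ j) (P $ j)) = - 2 *\<^sub>R (P $ i ** V $ i)" for i
  proof -
    have "P $ i ** (\<Sum>j\<in>UNIV. commutator (V $ j) (P $ j)) =
        (\<Sum>j\<in>UNIV. - (V $ i ** P $ j) + (if j = i then V $ i ** P $ i - P $ i ** V $ i else 0))"
      unfolding matmul.sum_right by (rule sum.cong) (auto simp: 4 5)
    also have "\<dots> = - (V $ i ** (\<Sum>j\<in>UNIV. P $ j)) + (V $ i ** P $ i - P $ i ** V $ i)"
      by (simp add: sum.distrib matmul.sum_right sum_negf sum_subtractf)
    also have "\<dots> = - (P $ i ** V $ i + V $ i ** P $ i) + (V $ i ** P $ i - P $ i ** V $ i)"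
      by (simp add: sum_id idem')
    finally show ?thesis by (simp add: scaleR_2)
  qed
  have "commutator (flag_lift P V) (P $ i) = V $ i" for i
  proof -
    have "commutator (flag_lift P V) (P $ i) = V $ i ** P $ i + P $ i ** V $ i"
      unfolding flag_lift_def commutator.scaleR_left commutator_def[of "sum _ _"] 3 6
      by (simp add: scaleR_add_right)
    then show ?thesis using idem'[of i] by (simp add: add.commute)
  qed
  then show ?thesis by (simp add: vec_eq_iff[where 'b='r])
qed

end

section \<open>Transitivity of the rotation group on flags\<close>

definition flag_block :: "('r::{finite,linorder} \<Rightarrow> nat) \<Rightarrow> 'r \<Rightarrow> 'n::{finite,linorder} set" where
  "flag_block q i = {a. card {c. c < a} \<in> {(\<Sum>l | l < i. q l) ..< (\<Sum>l | l \<le> i. q l)}}"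

lemma standard_flag_nth:
  "standard_flag q $ i $ a $ b = (if a = b \<and> a \<in> flag_block q i then 1 else 0)"
  by (simp add: standard_flag_def flag_block_def)

text \<open>The position is strictly increasing in the index and below n, so it is an injection
  between sets of equal size.\<close>

lemma card_less_bij:
  "bij_betw (\<lambda>a::'n::{finite,linorder}. card {c. c < a}) UNIV {..<CARD('n)}"
proof -
  let ?f = "\<lambda>a::'n. card {c. c < a}"
  have "strict_mono ?f"
    by (rule strict_monoI) (auto intro!: psubset_card_mono)
  then have "inj ?f" by (rule strict_mono_imp_inj_on)
  moreover have "?f a < CARD('n)" for a
    by (rule psubset_card_mono) auto
  then have "range ?f \<subseteq> {..<CARD('n)}" by auto
  ultimately show ?thesis
    by (simp add: bij_betw_def card_image card_subset_eq)
qed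

lemma flag_block_disjoint:
  assumes "a \<in> flag_block q i" "a \<in> flag_block q j" shows "i = j"
proof -
  have "\<not> i < j" if "a \<in> flag_block q i" "a \<in> flag_block q j" for i j
  proof
    assume "i < j"
    then have "(\<Sum>l | l \<le> i. q l) \<le> (\<Sum>l | l < j. q l)"
      by (intro sum_mono2) auto
    then show False using that by (auto simp: flag_block_def)
  qed
  then show ?thesis using assms by (meson linorder_less_linear)
qed

text \<open>The positions of a block fill an interval of length \<open>q i\<close>. The sum
  condition keeps this interval below n, so no position in it is missing.\<close>

lemma card_flag_block:
  fixes q :: "'r::{finite,linorder} \<Rightarrow> nat"
  assumes "(\<Sum>i\<in>UNIV. q i) = CARD('n::{finite,linorder})"
  shows "card (flag_block q i :: 'n set) = q i"
proof -
  let ?f = "\<lambda>a::'n. card {c. c < a}"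
  let ?I = "{(\<Sum>l | l < i. q l) ..< (\<Sum>l | l \<le> i. q l)}"
  have "{l. l \<le> i} = insert i {l. l < i}" by auto
  then have le: "(\<Sum>l | l \<le> i. q l) = q i + (\<Sum>l | l < i. q l)" by simp
  have "(\<Sum>l | l \<le> i. q l) \<le> CARD('n)"
    unfolding assms[symmetric] by (intro sum_mono2) auto
  then have "?f ` flag_block q i = ?I"
    using card_less_bij[where 'n='n] unfolding bij_betw_def flag_block_def
    by (auto simp: image_iff set_eq_iff) (metis le_less_trans less_le_trans not_less order_refl)
  moreover have "inj_on ?f (flag_block q i)"
    using card_less_bij[where 'n='n] unfolding bij_betw_def by (meson inj_on_subset subset_UNIV)
  ultimately have "card (flag_block q i :: 'n set) = card ?I" by (metis card_image)
  then show ?thesis using le by simp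
qed

lemma flag_block_exists:
  fixes q :: "'r::{finite,linorder} \<Rightarrow> nat"
  assumes "(\<Sum>i\<in>UNIV. q i) = CARD('n::{finite,linorder})"
  obtains i where "(a::'n) \<in> flag_block q i"
proof -
  have "card (\<Union>i. flag_block q i :: 'n set) = (\<Sum>i\<in>UNIV. card (flag_block q i :: 'n set))"
    by (intro card_UN_disjoint) (auto dest: flag_block_disjoint)
  then have "(\<Union>i. flag_block q i :: 'n set) = UNIV"
    by (intro card_subset_eq) (simp_all add: card_flag_block[OF assms] assms)
  then show thesis using that by blast
qed

lemma standard_flag_sum:
  fixes q :: "'r::{finite,linorder} \<Rightarrow> nat"
  assumes "(\<Sum>i\<in>UNIV. q i) = CARD('n::{finite,linorder})"
  shows "(\<Sum>i\<in>UNIV. (standard_flag q :: ('n, 'r) matrix_tuple) $ i) = mat 1"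
proof -
  have "(\<Sum>i\<in>UNIV. if a = b \<and> a \<in> flag_block q i then 1 else 0) = (if a = b then 1 else 0 :: real)" for a b :: 'n
  proof -
    obtain j where j: "a \<in> flag_block q j" using flag_block_exists[OF assms] by blast
    then have "a \<in> flag_block q i \<longleftrightarrow> i = j" for i using flag_block_disjoint by metis
    then show ?thesis by simp
  qed
  then show ?thesis by (simp add: vec_eq_iff standard_flag_nth mat_def)
qed

lemma flag_manifoldD:
  assumes "P \<in> flag_manifold q"
  shows "P $ i ** P $ i = P $ i" "transpose (P $ i) = P $ i" "rank (P $ i) = q i"
    "i \<noteq> j \<Longrightarrow> P $ i ** P $ j = 0"
  using assms by (auto simp: flag_manifold_def grassmannian_def)

lemma standard_flag_mult_column:
  "column b (Q ** standard_flag q $ i) = (if b \<in> flag_block q i then column b Q else 0)"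
proof -
  have "Q $ a $ k * standard_flag q $ i $ k $ b =
      (if k = b then if b \<in> flag_block q i then Q $ a $ b else 0 else 0)" for a k
    by (simp add: standard_flag_nth)
  then show ?thesis
    by (simp add: column_def matrix_matrix_mult_def vec_eq_iff)
qed

lemma column_matrix_mult: "column b (A ** B) = A *v column b B"
  by (simp add: column_def matrix_matrix_mult_def matrix_vector_mult_def)

lemma matrix_eq_columnsI: "(\<And>b. column b A = column b B) \<Longrightarrow> A = B"
  by (simp add: column_def vec_eq_iff)

text \<open>Orthonormal bases of the ranges of the projections, placed in the columns of the
  corresponding blocks, form an orthogonal matrix carrying the standard flag to \<open>P\<close>. A
  sign change of one column corrects the determinant if necessary.\<close>

lemma flag_transitive:
  fixes q :: "'r::{finite,linorder} \<Rightarrow> nat" and P :: "('n::{finite,linorder}, 'r) matrix_tuple"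
  assumes q: "(\<Sum>i\<in>UNIV. q i) = CARD('n)" and P: "P \<in> flag_manifold q"
  obtains Q where "Q \<in> SO_group" "flag_action Q (standard_flag q) = P"
proof -
  note P' = flag_manifoldD[OF P]
  have "\<exists>B. B \<subseteq> range ((*v) (P $ i)) \<and> pairwise orthogonal B \<and> (\<forall>x\<in>B. norm x = 1) \<and> card B = q i \<and> finite B" for i
  proof -
    have S: "subspace (range ((*v) (P $ i)))"
      by (metis linear_subspace_image matrix_vector_mul_linear subspace_UNIV)
    obtain B where "B \<subseteq> range ((*v) (P $ i))" "pairwise orthogonal B" "\<And>x. x \<in> B \<Longrightarrow> norm x = 1"
      "independent B" "card B = dim (range ((*v) (P $ i)))"
      by (rule orthonormal_basis_subspace[OF S]) blast
    then show ?thesis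
      using P'(3) by (intro exI[of _ B]) (auto simp: rank_dim_range independent_imp_finite)
  qed
  then obtain B where B: "\<And>i. B i \<subseteq> range ((*v) (P $ i))" "\<And>i. pairwise orthogonal (B i)"
    "\<And>i x. x \<in> B i \<Longrightarrow> norm x = 1" "\<And>i. card (B i) = q i" "\<And>i. finite (B i)"
    by metis
  have "\<exists>h. bij_betw h (flag_block q i :: 'n set) (B i)" for i
    by (rule finite_same_card_bij) (simp_all add: B card_flag_block[OF q])
  then obtain h where h: "\<And>i. bij_betw (h i) (flag_block q i :: 'n set) (B i)" by metis
  have "\<exists>i. a \<in> flag_block q i" for a :: 'n
    using flag_block_exists[OF q] by blast
  then obtain idx where idx: "\<And>a::'n. a \<in> flag_block q (idx a)" by metis
  have idx_eq: "a \<in> flag_block q i \<longleftrightarrow> i = idx a" for a i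
    using idx flag_block_disjoint by metis
  define f where "f a = h (idx a) a" for a
  have f: "f a \<in> B (idx a)" for a
    unfolding f_def using h idx by (meson bij_betwE)
  have Pf: "P $ i *v f a = (if i = idx a then f a else 0)" for i a
  proof -
    obtain y where y: "f a = P $ (idx a) *v y" using f B(1) by blast
    show ?thesis using P'(1,4) by (simp add: y matrix_vector_mul_assoc)
  qed
  have orth: "orthogonal (f a) (f b)" if "a \<noteq> b" for a b
  proof (cases "idx a = idx b")
    case True
    then have "f a \<noteq> f b" using h that idx unfolding f_def bij_betw_def inj_on_def by metis
    then show ?thesis using B(2) f True unfolding pairwise_def by metis
  next
    case False
    \<comment> \<open>Vectors from different blocks are orthogonal: the symmetric projection of the
      first block fixes \<open>f a\<close> and annihilates \<open>f b\<close>.\<close>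
    have "f a \<bullet> f b = (P $ idx a *v f a) \<bullet> f b" by (simp add: Pf)
    also have "\<dots> = f a \<bullet> (P $ idx a *v f b)"
      by (metis P'(2) dot_lmul_matrix transpose_matrix_vector)
    finally show ?thesis using False by (simp add: Pf orthogonal_def)
  qed
  define Q where "Q = (\<chi> a b. f b $ a)"
  have col: "column b Q = f b" for b by (simp add: Q_def column_def)
  have Q: "orthogonal_matrix Q"
    unfolding orthogonal_matrix_orthonormal_columns col
    by (intro conjI allI impI orth B(3)[OF f])
  have QP: "Q ** standard_flag q $ i = P $ i ** Q" for i
  proof (rule matrix_eq_columnsI)
    fix b
    have "column b (P $ i ** Q) = (if i = idx b then f b else 0)"
      unfolding column_matrix_mult col Pf ..
    moreover have "column b (Q ** standard_flag q $ i) = (if i = idx b then f b else 0)"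
      unfolding standard_flag_mult_column col idx_eq ..
    ultimately show "column b (Q ** standard_flag q $ i) = column b (P $ i ** Q)" by (rule trans[OF _ sym, rotated])
  qed
  obtain R where R: "rotation_matrix R" "\<And>i. R ** standard_flag q $ i = P $ i ** R"
  proof (cases "det Q = 1")
    case True
    then show thesis using Q QP that by (simp add: rotation_matrix_def)
  next
    case False
    then have "det Q = -1" using det_orthogonal_matrix[OF Q] by auto
    \<comment> \<open>\<open>undefined\<close> stands for an arbitrary fixed index. \<open>D\<close>
      reverses this one coordinate, so it has determinant -1, and being diagonal it commutes with
      the standard flag.\<close>
    define s :: "'n \<Rightarrow> real" where "s a = (if a = undefined then -1 else 1)" for a
    define D :: "((real, 'n) vec, 'n) vec" where "D = (\<chi> a b. if a = b then s a else 0)"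
    have D: "D $ a $ b = (if a = b then s a else 0)" for a b by (simp add: D_def)
    have ss: "s a * s a = 1" for a by (simp add: s_def)
    have "D $ k $ a * D $ k $ b = (if k = a then if a = b then 1 else 0 else 0)" for k a b
      by (simp add: D ss)
    then have "transpose D ** D = mat 1"
      by (simp add: transpose_def matrix_matrix_mult_def mat_def vec_eq_iff)
    then have "orthogonal_matrix (Q ** D)" using Q
      by (intro orthogonal_matrix_mul) (simp_all add: orthogonal_matrix)
    have "det D = (\<Prod>a\<in>UNIV. s a)"
      by (subst det_diagonal) (simp_all add: D)
    then have "det (Q ** D) = 1" using \<open>det Q = -1\<close> by (simp add: det_mul s_def)
    have DP: "D ** standard_flag q $ i = standard_flag q $ i ** D" for i
    proof -
      have "D $ a $ k * standard_flag q $ i $ k $ b = (if k = a then s a * standard_flag q $ i $ a $ b else 0)"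
        "standard_flag q $ i $ a $ k * D $ k $ b = (if k = b then s b * standard_flag q $ i $ a $ b else 0)" for a b k
        by (simp_all add: D)
      moreover have "s a * standard_flag q $ i $ a $ b = s b * standard_flag q $ i $ a $ b" for a b
        by (simp add: standard_flag_nth)
      ultimately show ?thesis by (simp add: matrix_matrix_mult_def vec_eq_iff)
    qed
    have "Q ** D ** standard_flag q $ i = P $ i ** (Q ** D)" for i
      by (simp only: matrix_mul_assoc[symmetric] DP) (simp only: matrix_mul_assoc QP)
    then show thesis using \<open>orthogonal_matrix (Q ** D)\<close> \<open>det (Q ** D) = 1\<close> that
      by (simp add: rotation_matrix_def)
  qed
  show thesis
  proof
    show "R \<in> SO_group" using R(1) by (simp add: SO_group_def)
    then show "flag_action R (standard_flag q) = P"
      by (simp add: flag_action_def R(2) SO_groupD vec_eq_iff[where 'b='r] matrix_mul_assoc[symmetric])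
  qed
qed

text \<open>Completeness is not a defining equation of a flag. It holds for the standard flag
  because the ranks add up to n, and conjugation by a rotation transports it to
  \<open>P\<close>.\<close>

lemma flag_manifold_projections:
  fixes P :: "('n::{finite,linorder}, 'r::{finite,linorder}) matrix_tuple"
  assumes "(\<Sum>i\<in>UNIV. q i) = CARD('n)" and P: "P \<in> flag_manifold q"
  shows "flag_projections P"
proof
  obtain Q where Q: "Q \<in> SO_group" "flag_action Q (standard_flag q) = P"
    using flag_transitive assms by blast
  have "(\<Sum>i\<in>UNIV. P $ i) = Q ** (\<Sum>i\<in>UNIV. standard_flag q $ i) ** transpose Q"
    by (simp add: Q(2)[symmetric] flag_action_def matmul.sum_left matmul.sum_right)
  then show "(\<Sum>i\<in>UNIV. P $ i) = mat 1"
    by (simp add: standard_flag_sum[OF assms(1)] SO_groupD[OF Q(1)])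
qed (use flag_manifoldD[OF P] in auto)

lemma flag_action_in_flag_manifold:
  assumes "Q \<in> SO_group" "P \<in> flag_manifold q"
  shows "flag_action Q P \<in> flag_manifold q"
proof -
  note P = flag_manifoldD[OF assms(2)] and Q = SO_groupD[OF assms(1)]
  have mul: "(Q ** A ** transpose Q) ** (Q ** B ** transpose Q) = Q ** (A ** B) ** transpose Q" for A B
    by (metis Q(1) matrix_mul_assoc matrix_mul_rid)
  have "rank (Q ** P $ i ** transpose Q) = rank (P $ i)" for i
  proof (rule antisym)
    show "rank (Q ** P $ i ** transpose Q) \<le> rank (P $ i)"
      by (meson order_trans rank_mul_le_left rank_mul_le_right)
    have "P $ i = transpose Q ** (Q ** P $ i ** transpose Q) ** Q"
      by (metis Q(1) matrix_mul_assoc matrix_mul_lid matrix_mul_rid)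
    then show "rank (P $ i) \<le> rank (Q ** P $ i ** transpose Q)"
      by (metis order_trans rank_mul_le_left rank_mul_le_right)
  qed
  moreover have "transpose (Q ** P $ i ** transpose Q) = Q ** P $ i ** transpose Q" for i
    by (simp add: matrix_transpose_mul P matrix_mul_assoc)
  ultimately show ?thesis
    by (simp add: flag_manifold_def grassmannian_def flag_action_def mul P)
qed

section \<open>The flag manifold and its metric\<close>

text \<open>The action is quadratic in the rotation; separating the two occurrences makes the
  bilinear product rule applicable.\<close>

lemma bounded_bilinear_flag_action:
  fixes P :: "real^'n^'n^'r::finite"
  shows "bounded_bilinear (\<lambda>(Q :: real^'n^'n) (R :: real^'n^'n). \<chi> i. Q ** P $ i ** transpose R)"
  unfolding bilinear_conv_bounded_bilinear[symmetric] bilinear_def linear_iff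
  by (simp add: vec_eq_iff[where 'b='r] matmul.add_left matmul.add_right
      matmul.scaleR_left matmul.scaleR_right transpose_simps)

lemma flag_action_deriv:
  "(\<chi> i. Q ** P $ i ** transpose (A ** Q)) + (\<chi> i. A ** Q ** P $ i ** transpose Q)
     = inf_rotation A (flag_action Q P)" if "A \<in> so_algebra"
  for P :: "real^'n^'n^'r::finite"
  using that by (simp add: vec_eq_iff[where 'b='r] flag_action_def commutator_def so_algebra_def
      transpose_simps matmul_distribs matrix_mul_assoc)

text \<open>The orbit under exp(tA) solves the linear equation with right-hand side
  \<open>inf_rotation A\<close>, which yields both its smoothness and its velocity.\<close>

lemma curve_through_flag_manifold:
  assumes A: "A \<in> so_algebra" and P: "P \<in> flag_manifold q"
  shows "curve_through (flag_manifold q) P (inf_rotation A P) (\<lambda>t. flag_action (matrix_exp A t) P)"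
proof -
  let ?c = "\<lambda>t. flag_action (matrix_exp A t) P"
  have d: "(?c has_vector_derivative inf_rotation A (?c t)) (at t)" for t
    using bounded_bilinear.has_vector_derivative[OF bounded_bilinear_flag_action[of P]
        matrix_exp_deriv[of A t] matrix_exp_deriv[of A t]]
    unfolding flag_action_deriv[OF A] flag_action_def[symmetric] .
  have 0: "?c 0 = P"
    by (simp add: flag_action_def)
  show ?thesis
    unfolding curve_through_def
  proof (intro conjI exI[of _ 1])
    show "smooth_on {-1<..<1} ?c"
      by (rule smooth_on_linear_ode[OF inf_rotation.bounded_linear_right d])
    show "?c ` {-1<..<1} \<subseteq> flag_manifold q"
      by (intro image_subsetI flag_action_in_flag_manifold matrix_exp_in_SO A P)
    show "(?c has_vector_derivative inf_rotation A P) (at 0)" using d[of 0] by (simp only: 0)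
  qed (simp_all only: 0)
qed

lemma inf_rotation_in_tangent_space:
  "A \<in> so_algebra \<Longrightarrow> P \<in> flag_manifold q \<Longrightarrow> inf_rotation A P \<in> tangent_space (flag_manifold q) P"
  using curve_through_flag_manifold unfolding tangent_space_def by blast

text \<open>The flag equations for idempotence, orthogonality, completeness and symmetry are
  differentiated along \<open>V\<close>; the algebra of projections then recovers \<open>V\<close>
  from its lift. Every tangent vector is therefore an infinitesimal rotation.\<close>

lemma tangent_space_flag_manifoldD:
  fixes P V :: "('n::{finite,linorder}, 'r::{finite,linorder}) matrix_tuple"
  assumes q: "(\<Sum>i\<in>UNIV. q i) = CARD('n)" and P: "P \<in> flag_manifold q"
    and V: "V \<in> tangent_space (flag_manifold q) P"
  shows "flag_lift P V \<in> so_algebra" "inf_rotation (flag_lift P V) P = V"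
proof -
  let ?F = "flag_manifold q :: ('n, 'r) matrix_tuple set"
  interpret flag_projections P by (rule flag_manifold_projections[OF q P])
  have nth: "has_mfd_deriv ?F (\<lambda>x. x $ i) P V (V $ i)" for i
    by (rule has_mfd_deriv_linear[OF bounded_linear_vec_nth has_mfd_deriv_ident])
  have mul: "has_mfd_deriv ?F (\<lambda>x. x $ i ** x $ j) P V (P $ i ** V $ j + V $ i ** P $ j)" for i j
    by (rule has_mfd_deriv_bilinear[OF bounded_bilinear_matrix_mult nth nth])
  have 1: "P $ i ** V $ i + V $ i ** P $ i = V $ i" for i
    by (rule has_mfd_deriv_unique[OF V has_mfd_deriv_cong[OF mul] nth]) (simp add: flag_manifoldD)
  have 2: "P $ i ** V $ j + V $ i ** P $ j = 0" if "i \<noteq> j" for i j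
    by (rule has_mfd_deriv_const_on[OF mul V]) (simp add: flag_manifoldD that)
  have "bounded_linear (\<lambda>x :: ('n, 'r) matrix_tuple. \<Sum>i\<in>UNIV. x $ i)"
    by (intro bounded_linear_sum bounded_linear_vec_nth)
  from has_mfd_deriv_linear_constraint[OF has_mfd_deriv_ident V this, of "mat 1"]
  have 3: "(\<Sum>i\<in>UNIV. V $ i) = 0"
    using flag_manifold_projections[OF q] flag_projections.sum_id by blast
  have sym: "transpose (V $ i) = V $ i" for i
    by (rule has_mfd_deriv_unique[OF V has_mfd_deriv_cong[OF has_mfd_deriv_linear[OF bounded_linear_transpose nth]] nth])
      (simp add: flag_manifoldD)
  show "flag_lift P V \<in> so_algebra" by (rule flag_lift_skew[OF symm sym])
  show "inf_rotation (flag_lift P V) P = V" by (rule inf_rotation_flag_lift[OF 1 2 3])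
qed

text \<open>Lifts are horizontal: lifting \<open>V\<close>, written as the infinitesimal rotation by
  its own lift, would otherwise remove a nonzero part.\<close>

lemma block_diag_flag_lift:
  fixes P V :: "('n::{finite,linorder}, 'r::{finite,linorder}) matrix_tuple"
  assumes q: "(\<Sum>i\<in>UNIV. q i) = CARD('n)" and P: "P \<in> flag_manifold q"
    and V: "V \<in> tangent_space (flag_manifold q) P"
  shows "block_diag P (flag_lift P V) = 0"
proof -
  interpret flag_projections P by (rule flag_manifold_projections[OF q P])
  show ?thesis
    using flag_lift_inf_rotation[of "flag_lift P V"] tangent_space_flag_manifoldD(2)[OF assms] by simp
qed

text \<open>A tangent space defined by curves is not visibly linear; here linearity is inherited
  from the skew matrices.\<close>

lemma tangent_space_flag_manifold_diff:
  fixes P U V :: "('n::{finite,linorder}, 'r::{finite,linorder}) matrix_tuple"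
  assumes q: "(\<Sum>i\<in>UNIV. q i) = CARD('n)" and P: "P \<in> flag_manifold q"
    and U: "U \<in> tangent_space (flag_manifold q) P" and V: "V \<in> tangent_space (flag_manifold q) P"
  shows "U - V \<in> tangent_space (flag_manifold q) P"
proof -
  have "U - V = inf_rotation (flag_lift P U - flag_lift P V) P"
    using tangent_space_flag_manifoldD(2)[OF q P U] tangent_space_flag_manifoldD(2)[OF q P V]
    by (simp add: inf_rotation.diff_left)
  also have "\<dots> \<in> tangent_space (flag_manifold q) P"
    by (intro inf_rotation_in_tangent_space P subspace_diff subspace_so_algebra
        tangent_space_flag_manifoldD(1)[OF q P] U V)
  finally show ?thesis .
qed

section \<open>The quotient metric in terms of horizontal lifts\<close>

lemma SO_metric_mult:
  assumes "Q \<in> SO_group"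
  shows "SO_metric Q (A ** Q) (B ** Q) = (A \<bullet> B) / 2"
proof -
  have "(transpose Q ** (A ** Q)) \<bullet> Z = A \<bullet> (Q ** Z ** transpose Q)" for Z
    using inner_matmul_left[of "transpose Q" "A ** Q" Z] inner_matmul_right[of A Q "Q ** Z"] by simp
  \<comment> \<open>The conjugations by \<open>Q\<close> cancel. This is bi-invariance: the metric,
    defined through \<open>Q ** \<Omega>\<close>, reads the same on \<open>A ** Q\<close>.\<close>
  moreover have "Q ** (transpose Q ** (B ** Q)) ** transpose Q = (Q ** transpose Q) ** B ** (Q ** transpose Q)"
    by (simp only: matrix_mul_assoc)
  ultimately show ?thesis
    by (simp add: SO_metric_def trace_transpose_mult SO_groupD[OF assms])
qed

lemma has_mfd_deriv_flag_action:
  fixes P :: "real^'n^'n^'r::finite"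
  assumes "A \<in> so_algebra"
  shows "has_mfd_deriv S (\<lambda>Q. flag_action Q P) Q (A ** Q) (inf_rotation A (flag_action Q P))"
  using has_mfd_deriv_bilinear[OF bounded_bilinear_flag_action has_mfd_deriv_ident has_mfd_deriv_ident,
      of S P Q "A ** Q"]
  unfolding flag_action_deriv[OF assms] flag_action_def[symmetric] .

lemma flag_action_mult: "flag_action (R ** Q) P = flag_action R (flag_action Q P)"
  by (simp add: flag_action_def matrix_transpose_mul matrix_mul_assoc)

text \<open>The fibre directions at \<open>Q\<close> are the \<open>H ** Q\<close> with
  \<open>H\<close> skew and block diagonal for \<open>P\<close>, and their orthogonal complement is
  described by the vanishing of the block diagonal part.\<close>

lemma horizontal_space_flag:
  fixes P P0 :: "('n::{finite,linorder}, 'r::{finite,linorder}) matrix_tuple"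
  assumes q: "(\<Sum>i\<in>UNIV. q i) = CARD('n)" and P: "P \<in> flag_manifold q"
    and Q: "Q \<in> SO_group" and QP: "flag_action Q P0 = P"
  shows "horizontal_space SO_group SO_metric (\<lambda>Q. flag_action Q P0) Q =
    {A ** Q | A. A \<in> so_algebra \<and> block_diag P A = 0}" (is "?H = ?R")
proof -
  interpret flag_projections P by (rule flag_manifold_projections[OF q P])
  let ?fib = "{R \<in> SO_group. flag_action R P0 = flag_action Q P0}"
  have sub: "?fib \<subseteq> SO_group" by blast
  show ?thesis
  proof (intro equalityI subsetI)
    fix \<xi> assume \<xi>: "\<xi> \<in> ?H"
    then have "\<xi> \<in> tangent_space SO_group Q" by (simp add: horizontal_space_def)
    then obtain A where A: "A \<in> so_algebra" "\<xi> = A ** Q" by (rule tangent_space_SO[OF _ Q])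
    define H where "H = block_diag P A"
    have H: "H \<in> so_algebra" unfolding H_def by (rule block_diag_skew[OF A(1)])
    \<comment> \<open>Since \<open>H\<close> commutes with each projection, exp(tH) fixes
      \<open>P\<close>; the curve through \<open>Q\<close> stays in the fibre, and
      \<open>H ** Q\<close> may be tested against \<open>\<xi>\<close>.\<close>
    have comm: "H ** P $ i = P $ i ** H" for i by (simp add: H_def block_diag_mult)
    let ?c = "\<lambda>t. matrix_exp H t ** Q"
    have "flag_action (?c t) P0 = P" for t
    proof -
      have "flag_action (matrix_exp H t) P = P"
        using matrix_exp_commute[OF H comm] SO_groupD(2)[OF matrix_exp_in_SO[OF H, of t]]
        by (simp add: flag_action_def vec_eq_iff[where 'b='r] matrix_mul_assoc[symmetric])
      then show ?thesis by (simp add: flag_action_mult QP)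
    qed
    then have "?c t \<in> ?fib" for t
      by (simp add: QP SO_group_mult matrix_exp_in_SO H Q)
    then have "\<exists>e>0. smooth_on {-e<..<e} ?c \<and> ?c ` {-e<..<e} \<subseteq> ?fib"
      using curve_through_SO[OF H Q] unfolding curve_through_def by blast
    then have "curve_through ?fib Q (H ** Q) ?c"
      using curve_through_SO[OF H Q] unfolding curve_through_def by simp
    then have "H ** Q \<in> tangent_space ?fib Q" unfolding tangent_space_def by blast
    then have "SO_metric Q \<xi> (H ** Q) = 0" using \<xi> by (simp add: horizontal_space_def)
    then have "A \<bullet> H = 0" by (simp add: A SO_metric_mult[OF Q])
    \<comment> \<open>\<open>block_diag\<close> is self-adjoint and idempotent, so the product of
      \<open>A\<close> with its projection \<open>H\<close> is the squared norm of
      \<open>H\<close>.\<close>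
    then have "H \<bullet> H = 0" by (simp add: H_def inner_block_diag block_diag_idem)
    then show "\<xi> \<in> ?R" using A by (auto simp: H_def)
  next
    fix \<xi> assume "\<xi> \<in> ?R"
    then obtain A where A: "A \<in> so_algebra" "\<xi> = A ** Q" "block_diag P A = 0" by blast
    have "\<xi> \<in> tangent_space SO_group Q"
      using curve_through_SO[OF A(1) Q] unfolding tangent_space_def A(2) by blast
    moreover have "SO_metric Q \<xi> \<eta> = 0" if \<eta>: "\<eta> \<in> tangent_space ?fib Q" for \<eta>
    proof -
      obtain H where H: "H \<in> so_algebra" "\<eta> = H ** Q"
        using tangent_space_SO[OF subsetD[OF tangent_space_mono[OF sub] \<eta>] Q] by blast
      \<comment> \<open>The orbit map is constant on the fibre, so its derivative along a fibre
        direction vanishes.\<close>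
      have "inf_rotation H P = 0"
        by (rule has_mfd_deriv_const_on[OF has_mfd_deriv_flag_action[OF H(1), of ?fib P0 Q, unfolded QP] \<eta>[unfolded H(2) QP]])
          (simp add: QP)
      then have "block_diag P H = H" by (rule block_diag_eq_0_if_fixed)
      then have "A \<bullet> H = 0" using inner_block_diag[of A H] A(3) by simp
      then show ?thesis by (simp add: A(2) H(2) SO_metric_mult[OF Q])
    qed
    ultimately show "\<xi> \<in> ?H" by (simp add: horizontal_space_def)
  qed
qed

lemma flag_metric_eq:
  fixes P U V :: "('n::{finite,linorder}, 'r::{finite,linorder}) matrix_tuple"
  assumes q: "(\<Sum>i\<in>UNIV. q i) = CARD('n)" and P: "P \<in> flag_manifold q"
    and U: "U \<in> tangent_space (flag_manifold q) P" and V: "V \<in> tangent_space (flag_manifold q) P"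
  shows "flag_metric q P U V = (flag_lift P U \<bullet> flag_lift P V) / 2"
proof -
  let ?f = "\<lambda>Q. flag_action Q (standard_flag q) :: ('n, 'r) matrix_tuple"
  let ?H = "horizontal_space SO_group SO_metric ?f"
  interpret flag_projections P by (rule flag_manifold_projections[OF q P])
  have deriv: "mfd_deriv SO_group ?f Q (A ** Q) = inf_rotation A P"
    if "Q \<in> SO_group" "?f Q = P" "A \<in> so_algebra" for Q A
  proof (rule mfd_deriv_eq)
    show "A ** Q \<in> tangent_space SO_group Q"
      using curve_through_SO[OF that(3,1)] unfolding tangent_space_def by blast
    show "has_mfd_deriv SO_group ?f Q (A ** Q) (inf_rotation A P)"
      using has_mfd_deriv_flag_action[OF that(3), of SO_group "standard_flag q" Q] that(2) by simp
  qed
  have lift: "flag_lift P W = A" if "inf_rotation A P = W" "block_diag P A = 0" for A W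
    using flag_lift_inf_rotation[of A] that by simp
  have *: "SO_metric Q \<xi> \<eta> = (flag_lift P U \<bullet> flag_lift P V) / 2"
    if Q: "Q \<in> SO_group" "?f Q = P" and \<xi>: "\<xi> \<in> ?H Q" "mfd_deriv SO_group ?f Q \<xi> = U"
      and \<eta>: "\<eta> \<in> ?H Q" "mfd_deriv SO_group ?f Q \<eta> = V" for Q \<xi> \<eta>
  proof -
    obtain A B where A: "\<xi> = A ** Q" "A \<in> so_algebra" "block_diag P A = 0"
      and B: "\<eta> = B ** Q" "B \<in> so_algebra" "block_diag P B = 0"
      using \<xi>(1) \<eta>(1) unfolding horizontal_space_flag[OF q P Q] by blast
    have "flag_lift P U = A" "flag_lift P V = B"
      using \<xi>(2) \<eta>(2) A B deriv[OF Q] lift by auto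
    then show ?thesis by (simp add: A B SO_metric_mult[OF Q(1)])
  qed
  \<comment> \<open>One actual rotation over \<open>P\<close>, with horizontal lifts of
    \<open>U\<close> and \<open>V\<close> at it, pins down the number in the definite description;
    agreement over all rotations alone would not give uniqueness.\<close>
  obtain Q where Q: "Q \<in> SO_group" "?f Q = P" using flag_transitive[OF q P] by blast
  have hor: "flag_lift P W ** Q \<in> ?H Q" "mfd_deriv SO_group ?f Q (flag_lift P W ** Q) = W"
    if "W \<in> tangent_space (flag_manifold q) P" for W
    using tangent_space_flag_manifoldD[OF q P that] block_diag_flag_lift[OF q P that] deriv[OF Q]
    unfolding horizontal_space_flag[OF q P Q] by auto
  show ?thesis
    unfolding flag_metric_def quotient_metric_def
  proof (rule the_equality)
    show "\<forall>Q\<in>SO_group. \<forall>\<xi>\<in>?H Q. \<forall>\<eta>\<in>?H Q. ?f Q = P \<and> mfd_deriv SO_group ?f Q \<xi> = U \<and>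
        mfd_deriv SO_group ?f Q \<eta> = V \<longrightarrow> (flag_lift P U \<bullet> flag_lift P V) / 2 = SO_metric Q \<xi> \<eta>"
      using * by simp
    fix s assume "\<forall>Q\<in>SO_group. \<forall>\<xi>\<in>?H Q. \<forall>\<eta>\<in>?H Q. ?f Q = P \<and> mfd_deriv SO_group ?f Q \<xi> = U \<and>
        mfd_deriv SO_group ?f Q \<eta> = V \<longrightarrow> s = SO_metric Q \<xi> \<eta>"
    then have "s = SO_metric Q (flag_lift P U ** Q) (flag_lift P V ** Q)"
      using Q hor[OF U] hor[OF V] by blast
    then show "s = (flag_lift P U \<bullet> flag_lift P V) / 2" by (simp add: SO_metric_mult[OF Q(1)])
  qed
qed

section \<open>The Levi-Civita connection\<close>

definition field_lift :: "(real^'n^'n^'r \<Rightarrow> real^'n^'n^'r::finite) \<Rightarrow> real^'n^'n^'r \<Rightarrow> real^'n^'n" where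
  "field_lift X p = flag_lift p (X p)"

definition field_lift_deriv ::
  "(real^'n^'n^'r) set \<Rightarrow> (real^'n^'n^'r \<Rightarrow> real^'n^'n^'r::finite) \<Rightarrow> real^'n^'n^'r \<Rightarrow> real^'n^'n^'r \<Rightarrow> real^'n^'n"
  where "field_lift_deriv M X p v = mfd_deriv M (field_lift X) p v"

text \<open>The right-hand side of the claimed formula, with the derivative along the geodesic
  replaced by the differential of the lift in the direction \<open>X p\<close>.\<close>

definition flag_connection ::
  "(real^'n^'n^'r) set \<Rightarrow> (real^'n^'n^'r \<Rightarrow> real^'n^'n^'r) \<Rightarrow> (real^'n^'n^'r \<Rightarrow> real^'n^'n^'r::finite) \<Rightarrow>
    real^'n^'n^'r \<Rightarrow> real^'n^'n^'r" where
  "flag_connection M X Y p =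
     inf_rotation (field_lift_deriv M Y p (X p) - (1/2) *\<^sub>R commutator (field_lift X p) (field_lift Y p)) p"

locale flag_type =
  fixes q :: "'r::{finite,linorder} \<Rightarrow> nat" and F :: "('n::{finite,linorder}, 'r) matrix_tuple set"
  assumes q: "(\<Sum>i\<in>UNIV. q i) = CARD('n)"
    and F_def: "F = flag_manifold q"
begin

lemma vector_fieldD:
  assumes "X \<in> vector_fields F" "p \<in> F"
  shows "X p \<in> tangent_space F p" "field_lift X p \<in> so_algebra"
    "inf_rotation (field_lift X p) p = X p"
  using assms tangent_space_flag_manifoldD[OF q, of p "X p"]
  by (auto simp: vector_fields_def F_def field_lift_def)

text \<open>Supplies a global smooth field through any given tangent vector: apply it to the lift of
  that vector.\<close>

lemma inf_rotation_vector_field: "A \<in> so_algebra \<Longrightarrow> inf_rotation A \<in> vector_fields F"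
  by (simp add: vector_fields_def F_def inf_rotation_in_tangent_space smooth_on_bounded_linear
      inf_rotation.bounded_linear_right)

text \<open>The lift is bilinear in point and field value, hence differentiable along the manifold,
  and its derivative inherits skewness. The product rule for
  \<open>Y p = inf_rotation (field_lift Y p) p\<close> gives the last claim.\<close>

lemma field_lift_has_deriv:
  assumes Y: "Y \<in> vector_fields F" and p: "p \<in> F" and v: "v \<in> tangent_space F p"
  shows "has_mfd_deriv F (field_lift Y) p v (field_lift_deriv F Y p v)"
    "field_lift_deriv F Y p v \<in> so_algebra"
    "has_mfd_deriv F Y p v (inf_rotation (field_lift Y p) v + inf_rotation (field_lift_deriv F Y p v) p)"
proof -
  have "smooth_on F Y" using Y by (simp add: vector_fields_def)
  then obtain w where w: "has_mfd_deriv F Y p v w" using smooth_on_has_mfd_deriv p by metis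
  have d: "has_mfd_deriv F (field_lift Y) p v (flag_lift p w + flag_lift v (Y p))"
    unfolding field_lift_def[abs_def]
    by (rule has_mfd_deriv_bilinear[OF bounded_bilinear_flag_lift has_mfd_deriv_ident w])
  then show 1: "has_mfd_deriv F (field_lift Y) p v (field_lift_deriv F Y p v)"
    unfolding field_lift_deriv_def using mfd_deriv_eq[OF v d] by simp
  have L: "bounded_linear (\<lambda>A :: ((real, 'n) vec, 'n) vec. transpose A + A)"
    by (intro bounded_linear_add bounded_linear_transpose bounded_linear_ident)
  have "transpose (field_lift_deriv F Y p v) + field_lift_deriv F Y p v = 0"
    using has_mfd_deriv_linear_constraint[OF 1 v L, of 0] vector_fieldD(2)[OF Y]
    by (simp add: so_algebra_def)
  then show "field_lift_deriv F Y p v \<in> so_algebra"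
    by (simp add: so_algebra_def add_eq_0_iff2)
  show "has_mfd_deriv F Y p v (inf_rotation (field_lift Y p) v + inf_rotation (field_lift_deriv F Y p v) p)"
    by (rule has_mfd_deriv_cong[OF has_mfd_deriv_bilinear[OF bounded_bilinear_inf_rotation 1 has_mfd_deriv_ident]])
      (simp add: vector_fieldD Y)
qed

lemma flag_connection_arg_skew:
  assumes "X \<in> vector_fields F" "Y \<in> vector_fields F" "p \<in> F"
  shows "field_lift_deriv F Y p (X p) - (1/2) *\<^sub>R commutator (field_lift X p) (field_lift Y p) \<in> so_algebra"
  using assms
  by (intro subspace_diff subspace_scale subspace_so_algebra so_algebra_commutator
      vector_fieldD field_lift_has_deriv) auto

lemma flag_connection_tangent:
  assumes "X \<in> vector_fields F" "Y \<in> vector_fields F" "p \<in> F"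
  shows "flag_connection F X Y p \<in> tangent_space F p"
  using inf_rotation_in_tangent_space[OF flag_connection_arg_skew[OF assms], of p q] assms(3)
  by (simp add: flag_connection_def F_def)

lemma flag_connection_torsion:
  assumes X: "X \<in> vector_fields F" and Y: "Y \<in> vector_fields F" and p: "p \<in> F"
  shows "flag_connection F X Y p - flag_connection F Y X p = mfd_deriv F Y p (X p) - mfd_deriv F X p (Y p)"
proof -
  note Xp = vector_fieldD[OF X p] and Yp = vector_fieldD[OF Y p]
  let ?a = "field_lift X p" and ?b = "field_lift Y p"
  have "mfd_deriv F Y p (X p) - mfd_deriv F X p (Y p) =
      inf_rotation (field_lift_deriv F Y p (X p) - field_lift_deriv F X p (Y p)) p +
      (inf_rotation ?b (inf_rotation ?a p) - inf_rotation ?a (inf_rotation ?b p))"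
    using mfd_deriv_eq[OF Xp(1) field_lift_has_deriv(3)[OF Y p Xp(1)]]
      mfd_deriv_eq[OF Yp(1) field_lift_has_deriv(3)[OF X p Yp(1)]]
    by (simp add: Xp(3) Yp(3) inf_rotation.diff_left)
  also have "inf_rotation ?b (inf_rotation ?a p) - inf_rotation ?a (inf_rotation ?b p) =
      inf_rotation (commutator ?b ?a) p"
    by (simp add: vec_eq_iff[where 'b='r] commutator_Jacobi)
  \<comment> \<open>The Jacobi identity leaves one full bracket; half of it belongs to each of the
    two connection terms.\<close>
  also have "commutator ?b ?a = - (1/2) *\<^sub>R commutator ?a ?b + (1/2) *\<^sub>R commutator ?b ?a"
    by (simp add: commutator_def scaleR_diff_right)
  finally show ?thesis
    by (simp add: flag_connection_def inf_rotation.diff_left inf_rotation.add_left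
        inf_rotation.scaleR_left inf_rotation.minus_left)
qed

text \<open>The block diagonal part lost in lifting \<open>A\<close> is orthogonal to the horizontal
  lift of \<open>v\<close>.\<close>

lemma flag_lift_inf_rotation_inner:
  assumes "p \<in> F" "v \<in> tangent_space F p"
  shows "flag_lift p (inf_rotation A p) \<bullet> flag_lift p v = A \<bullet> flag_lift p v"
proof -
  interpret flag_projections p using flag_manifold_projections[OF q] assms(1) by (simp add: F_def)
  show ?thesis
    using block_diag_flag_lift[OF q, of p v] assms
    by (simp add: flag_lift_inf_rotation inner_diff_left inner_block_diag F_def)
qed

text \<open>Paired with horizontal lifts, the connection contributes the derivatives of the lifts
  and two half brackets, which cancel by ad-invariance.\<close>

lemma flag_connection_metric:
  assumes X: "X \<in> vector_fields F" and Y: "Y \<in> vector_fields F" and Z: "Z \<in> vector_fields F" and p: "p \<in> F"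
  shows "flag_lift p (flag_connection F X Y p) \<bullet> field_lift Z p +
      field_lift Y p \<bullet> flag_lift p (flag_connection F X Z p) =
    field_lift_deriv F Y p (X p) \<bullet> field_lift Z p + field_lift Y p \<bullet> field_lift_deriv F Z p (X p)"
proof -
  have "flag_lift p (flag_connection F X Y p) \<bullet> field_lift Z p =
      (field_lift_deriv F Y p (X p) - (1/2) *\<^sub>R commutator (field_lift X p) (field_lift Y p)) \<bullet> field_lift Z p"
    if "Z \<in> vector_fields F" for Y Z
    unfolding flag_connection_def field_lift_def[of Z]
    by (rule flag_lift_inf_rotation_inner[OF p vector_fieldD(1)[OF that p]])
  from this[OF Z, of Y] this[OF Y, of Z] show ?thesis
    using inner_skew_commutator[OF vector_fieldD(2)[OF X p], of "field_lift Y p" "field_lift Z p"]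
    by (simp add: inner_diff_left inner_diff_right inner_commute)
qed

lemma flag_metric_deriv:
  assumes Y: "Y \<in> vector_fields F" and Z: "Z \<in> vector_fields F" and p: "p \<in> F"
    and v: "v \<in> tangent_space F p"
  shows "mfd_deriv F (\<lambda>x. flag_metric q x (Y x) (Z x)) p v =
    (field_lift Y p \<bullet> field_lift_deriv F Z p v + field_lift_deriv F Y p v \<bullet> field_lift Z p) / 2"
proof (rule mfd_deriv_eq[OF v has_mfd_deriv_cong])
  show "has_mfd_deriv F (\<lambda>x. (field_lift Y x \<bullet> field_lift Z x) / 2) p v
      ((field_lift Y p \<bullet> field_lift_deriv F Z p v + field_lift_deriv F Y p v \<bullet> field_lift Z p) / 2)"
    by (intro has_mfd_deriv_linear[OF bounded_linear_divide]
        has_mfd_deriv_bilinear[OF bounded_bilinear_inner] field_lift_has_deriv Y Z p v)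
  show "(field_lift Y x \<bullet> field_lift Z x) / 2 = flag_metric q x (Y x) (Z x)" if "x \<in> F" for x
    using flag_metric_eq[OF q] vector_fieldD(1)[OF Y that] vector_fieldD(1)[OF Z that] that
    by (simp add: F_def field_lift_def)
qed

text \<open>
  The difference of two torsion-free metric connections is symmetric in its two arguments and
  skew in the last two slots of the associated trilinear form, hence zero.
\<close>

theorem levi_civita_flag_connection:
  assumes LC: "levi_civita_connection F (flag_metric q) nabla"
    and X: "X \<in> vector_fields F" and Y: "Y \<in> vector_fields F" and p: "p \<in> F"
  shows "nabla X Y p = flag_connection F X Y p"
proof -
  have torsion_free: "torsion_free F nabla" and metric_compatible: "metric_compatible F (flag_metric q) nabla"
    using LC by (simp_all add: levi_civita_connection_def)
  note tangent_diff = tangent_space_flag_manifold_diff[OF q, of p, folded F_def, OF p]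
  have nabla: "nabla X Y \<in> vector_fields F" if "X \<in> vector_fields F" "Y \<in> vector_fields F" for X Y
    using LC that by (simp add: levi_civita_connection_def affine_connection_def)
  \<comment> \<open>Torsion-freeness speaks of the action on functions. Testing it on the linear
    functions \<open>\<lambda>x. x \<bullet> e\<close> turns it into an equation between matrix
    tuples.\<close>
  have torsion: "nabla X Y p - nabla Y X p = mfd_deriv F Y p (X p) - mfd_deriv F X p (Y p)"
    if X: "X \<in> vector_fields F" and Y: "Y \<in> vector_fields F" for X Y
  proof -
    have lin: "mfd_deriv F (\<lambda>x. x \<bullet> e) x v = v \<bullet> e" if "v \<in> tangent_space F x" for x v e
      by (rule mfd_deriv_eq[OF that has_mfd_deriv_linear[OF bounded_linear_inner_left has_mfd_deriv_ident]])
    have second: "mfd_deriv F (\<lambda>x. mfd_deriv F (\<lambda>x. x \<bullet> e) x (Y x)) p v = mfd_deriv F Y p v \<bullet> e"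
      if Y: "Y \<in> vector_fields F" and v: "v \<in> tangent_space F p" for Y v e
    proof (rule mfd_deriv_eq[OF v has_mfd_deriv_cong])
      have "has_mfd_deriv F Y p v (mfd_deriv F Y p v)"
        using field_lift_has_deriv(3)[OF Y p v] mfd_deriv_eq[OF v] by metis
      then show "has_mfd_deriv F (\<lambda>x. Y x \<bullet> e) p v (mfd_deriv F Y p v \<bullet> e)"
        by (rule has_mfd_deriv_linear[OF bounded_linear_inner_left])
      show "Y x \<bullet> e = mfd_deriv F (\<lambda>x. x \<bullet> e) x (Y x)" if "x \<in> F" for x
        by (simp add: lin vector_fieldD(1)[OF Y that])
    qed
    have "(nabla X Y p - nabla Y X p) \<bullet> e = (mfd_deriv F Y p (X p) - mfd_deriv F X p (Y p)) \<bullet> e" for e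
    proof -
      have "smooth_on F (\<lambda>x. x \<bullet> e)" by (rule smooth_on_bounded_linear[OF bounded_linear_inner_left])
      then have "mfd_deriv F (\<lambda>x. x \<bullet> e) p (nabla X Y p - nabla Y X p) =
          mfd_deriv F (\<lambda>x. mfd_deriv F (\<lambda>x. x \<bullet> e) x (Y x)) p (X p)
          - mfd_deriv F (\<lambda>x. mfd_deriv F (\<lambda>x. x \<bullet> e) x (X x)) p (Y p)"
        using torsion_free[unfolded torsion_free_def, rule_format, OF X Y _ p] by simp
      moreover have "nabla X Y p - nabla Y X p \<in> tangent_space F p"
        by (intro tangent_diff vector_fieldD(1) nabla X Y p)
      ultimately show ?thesis
        by (simp add: lin second X Y vector_fieldD(1) p inner_diff_left)
    qed
    then show ?thesis using vector_eq_rdot by blast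
  qed
  have metric: "flag_lift p (nabla X Y p) \<bullet> field_lift Z p + field_lift Y p \<bullet> flag_lift p (nabla X Z p) =
      field_lift_deriv F Y p (X p) \<bullet> field_lift Z p + field_lift Y p \<bullet> field_lift_deriv F Z p (X p)"
    if X: "X \<in> vector_fields F" and Y: "Y \<in> vector_fields F" and Z: "Z \<in> vector_fields F" for X Y Z
  proof -
    have "mfd_deriv F (\<lambda>x. flag_metric q x (Y x) (Z x)) p (X p) =
        flag_metric q p (nabla X Y p) (Z p) + flag_metric q p (Y p) (nabla X Z p)"
      by (rule metric_compatible[unfolded metric_compatible_def, rule_format, OF X Y Z p])
    then show ?thesis
      using flag_metric_eq[OF q, of p, folded F_def, OF p] flag_metric_deriv[OF Y Z p vector_fieldD(1)[OF X p]]
      by (simp add: vector_fieldD(1) nabla X Y Z p field_lift_def)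
  qed
  define E where "E X Y = flag_lift p (nabla X Y p - flag_connection F X Y p)" for X Y
  have E_sym: "E X Y = E Y X" if "X \<in> vector_fields F" "Y \<in> vector_fields F" for X Y
  proof -
    have "nabla X Y p = flag_connection F X Y p - flag_connection F Y X p + nabla Y X p"
      using torsion[OF that] flag_connection_torsion[OF that p] by (simp add: diff_eq_eq)
    then have "nabla X Y p - flag_connection F X Y p = nabla Y X p - flag_connection F Y X p" by simp
    then show ?thesis by (simp add: E_def)
  qed
  have E_skew: "E X Y \<bullet> field_lift Z p = - (field_lift Y p \<bullet> E X Z)"
    if "X \<in> vector_fields F" "Y \<in> vector_fields F" "Z \<in> vector_fields F" for X Y Z
    using metric[OF that] flag_connection_metric[OF that p]
    by (simp add: E_def flag_lift.diff_right inner_diff_left inner_diff_right)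
  \<comment> \<open>Three cyclic uses of skewness, linked by symmetry, show that the trilinear form
    equals its own negative.\<close>
  have E_zero: "E X Y \<bullet> field_lift Z p = 0" if Z: "Z \<in> vector_fields F" for Z
    using E_skew[OF X Y Z] E_skew[OF Z X Y] E_skew[OF Y Z X] E_sym[OF X Y] E_sym[OF X Z] E_sym[OF Y Z]
    by (simp add: inner_commute)
  have t: "nabla X Y p - flag_connection F X Y p \<in> tangent_space F p"
    by (intro tangent_diff vector_fieldD(1)[OF nabla] flag_connection_tangent X Y p)
  note E = tangent_space_flag_manifoldD[OF q _ t[unfolded F_def], folded F_def, OF p, folded E_def]
  \<comment> \<open>The test field is the rotation field generated by \<open>E X Y\<close>, whose
    lift at \<open>p\<close> is \<open>E X Y\<close> itself.\<close>
  have "E X Y \<bullet> E X Y = 0"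
    using E_zero[OF inf_rotation_vector_field[OF E(1)]] E(2) by (simp add: field_lift_def E_def)
  then show ?thesis using E(2) by (simp add: inf_rotation.zero_left)
qed

end

section \<open>The connection formula along the geodesic\<close>

theorem theorem2:
  fixes q :: "'r::{finite,linorder} \<Rightarrow> nat"
    and X Y :: "('n::{finite,linorder}, 'r) matrix_tuple \<Rightarrow> ('n, 'r) matrix_tuple"
    and nabla :: "(('n, 'r) matrix_tuple \<Rightarrow> ('n, 'r) matrix_tuple) \<Rightarrow> (('n, 'r) matrix_tuple \<Rightarrow> ('n, 'r) matrix_tuple) \<Rightarrow>
                    ('n, 'r) matrix_tuple \<Rightarrow> ('n, 'r) matrix_tuple"
    and \<beta> :: "('n, 'r) matrix_tuple"
    and \<Gamma> :: "real \<Rightarrow> ('n, 'r) matrix_tuple"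
    and J :: "real set"
  assumes "2 \<le> CARD('r)"
    and "\<And>i. 0 < q i"
    and "(\<Sum>i\<in>UNIV. q i) = CARD('n)"
    and "levi_civita_connection (flag_manifold q) (flag_metric q) nabla"
    and "X \<in> vector_fields (flag_manifold q)"
    and "Y \<in> vector_fields (flag_manifold q)"
    and "\<beta> \<in> flag_manifold q"
    and "geodesic_on (flag_manifold q) nabla J \<Gamma>"
    and "0 \<in> J"
    and "\<Gamma> 0 = \<beta>"
    and "vector_derivative \<Gamma> (at 0) = X \<beta>"
  shows "Omega_deriv Y \<Gamma> \<in> so_algebra
    \<and> Omega_bracket X Y \<beta> \<in> so_algebra
    \<and> nabla X Y \<beta> =
        (\<chi> i. commutator (Omega_deriv Y \<Gamma> - (1/8) *\<^sub>R Omega_bracket X Y \<beta>) (\<beta> $ i))"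
proof -
  define F :: "('n, 'r) matrix_tuple set" where "F = flag_manifold q"
  interpret flag_type q F
    by unfold_locales (simp_all add: assms(3) F_def)
  have X: "X \<in> vector_fields F" and Y: "Y \<in> vector_fields F" and \<beta>: "\<beta> \<in> F"
    using assms by (simp_all add: F_def)
  note X\<beta> = vector_fieldD[OF X \<beta>] and Y\<beta> = vector_fieldD[OF Y \<beta>]
  have \<Gamma>: "open J" "smooth_on J \<Gamma>" "\<Gamma> ` J \<subseteq> F"
    using assms(8) by (auto simp: geodesic_on_def F_def)
  obtain e where e: "e > 0" "{-e<..<e} \<subseteq> J"
  proof -
    obtain e where "e > 0" "ball 0 e \<subseteq> J" by (rule openE[OF \<Gamma>(1) assms(9)])
    moreover have "{-e<..<e} = ball (0::real) e" by (auto simp: dist_real_def)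
    ultimately show thesis using that by simp
  qed
  have "curve_through F \<beta> (X \<beta>) \<Gamma>"
  proof -
    \<comment> \<open>\<open>vector_derivative\<close> is meaningful only where a derivative exists;
      differentiability of \<open>\<Gamma>\<close> at 0 is taken from a local smooth extension,
      which agrees with \<open>\<Gamma>\<close> on the open set \<open>U \<inter> J\<close>.\<close>
    obtain U h where U: "open U" "0 \<in> U" "\<forall>k. Ck_on k U h" "\<forall>x\<in>U \<inter> J. h x = \<Gamma> x"
      using \<Gamma>(2) assms(9) unfolding smooth_on_def by blast
    have "Ck_on (Suc 0) U h" using U(3) by blast
    then have "h differentiable (at 0)" using U(2) by simp
    then have "(h has_vector_derivative vector_derivative h (at 0)) (at 0)"
      by (simp add: vector_derivative_works)
    then have "(\<Gamma> has_vector_derivative vector_derivative h (at 0)) (at 0)"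
      by (rule has_vector_derivative_transform_within_open[of _ _ _ "U \<inter> J"])
        (use U \<Gamma>(1) assms(9) in auto)
    then have "(\<Gamma> has_vector_derivative X \<beta>) (at 0)"
      using vector_derivative_at assms(11) by metis
    moreover have "smooth_on {-e<..<e} \<Gamma>" by (rule smooth_on_subset[OF \<Gamma>(2) e(2)])
    moreover have "\<Gamma> ` {-e<..<e} \<subseteq> F" using \<Gamma>(3) e(2) by blast
    ultimately show ?thesis
      unfolding curve_through_def using e(1) assms(10) by (intro conjI exI[of _ e]) simp_all
  qed
  then have "((field_lift Y \<circ> \<Gamma>) has_vector_derivative field_lift_deriv F Y \<beta> (X \<beta>)) (at 0)"
    using field_lift_has_deriv(1)[OF Y \<beta> X\<beta>(1)] by (simp add: has_mfd_deriv_def)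
  \<comment> \<open>The factor 2 undoes the one half in \<open>flag_lift\<close>; it then cancels
    the one half in \<open>Omega_deriv\<close>.\<close>
  from bounded_linear.has_vector_derivative[OF bounded_linear_scaleR_right[of 2] this]
  have "((\<lambda>t. \<Sum>j\<in>UNIV. commutator (Y (\<Gamma> t) $ j) (\<Gamma> t $ j)) has_vector_derivative
      2 *\<^sub>R field_lift_deriv F Y \<beta> (X \<beta>)) (at 0)"
    by (simp add: field_lift_def flag_lift_def)
  then have deriv: "Omega_deriv Y \<Gamma> = field_lift_deriv F Y \<beta> (X \<beta>)"
    by (simp add: Omega_deriv_def vector_derivative_at)
  \<comment> \<open>The double sum splits by bilinearity, and each single sum is twice a lift. The
    resulting factor 4 turns the coefficient 1/8 into the 1/2 of
    \<open>flag_connection\<close>.\<close>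
  have "Omega_bracket X Y \<beta> = commutator (2 *\<^sub>R field_lift X \<beta>) (2 *\<^sub>R field_lift Y \<beta>)"
    by (simp add: Omega_bracket_def field_lift_def flag_lift_def commutator.sum_left commutator.sum_right)
      (rule sum.swap)
  then have bracket: "Omega_bracket X Y \<beta> = 4 *\<^sub>R commutator (field_lift X \<beta>) (field_lift Y \<beta>)"
    by (simp add: commutator.scaleR_left commutator.scaleR_right)
  have "nabla X Y \<beta> = inf_rotation (Omega_deriv Y \<Gamma> - (1/8) *\<^sub>R Omega_bracket X Y \<beta>) \<beta>"
    using levi_civita_flag_connection[OF assms(4)[folded F_def] X Y \<beta>]
    by (simp add: flag_connection_def deriv bracket)
  moreover have "Omega_bracket X Y \<beta> \<in> so_algebra"
    unfolding bracket by (intro subspace_scale subspace_so_algebra so_algebra_commutator X\<beta> Y\<beta>)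
  ultimately show ?thesis
    using field_lift_has_deriv(2)[OF Y \<beta> X\<beta>(1)] by (simp add: deriv inf_rotation_def)
qed

end
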